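(* Let $s\ge 2$ be an integer with $s\neq 3$, and let $B$ be a ball in $\mathbb{R}^{2s}$, either open or closed. Then $B$ is $m$-divisible for every integer $m\ge 4(2s+1)+2$.
   Context: For a cardinal number $m$, a set $K\subset\mathbb{R}^d$ is called $m$-divisible if $K$ can be decomposed into $m$ pairwise disjoint pieces which are congruent to each other, i.e. any two pieces are mapped onto each other by an isometry of $\mathbb{R}^d$ (an element of the full isometry group of $d$-dimensional Euclidean space). *)

theory Defs
  imports "HOL-Analysis.Analysis"
begin

definition space_isometry :: "('a::metric_space \<Rightarrow> 'a) \<Rightarrow> bool" where
  "space_isometry f \<longleftrightarrow> surj f \<and> (\<forall>x y. dist (f x) (f y) = dist x y)"

definition congruent_sets :: "'a::metric_space set \<Rightarrow> 'a set \<Rightarrow> bool" where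
  "congruent_sets A B \<longleftrightarrow> (\<exists>f. space_isometry f \<and> f ` A = B)"

(* The cardinal number m of pieces is represented by an index set I of cardinality m;
   for a natural number m take I = {..<m}.  Since the pieces are congruent, they are all
   nonempty (and hence pairwise distinct) whenever K is nonempty. *)
definition divisible :: "'i set \<Rightarrow> 'a::metric_space set \<Rightarrow> bool" where
  "divisible I K \<longleftrightarrow>
     (\<exists>P. disjoint_family_on P I \<and> (\<Union>i\<in>I. P i) = K \<and>
          (\<forall>i\<in>I. \<forall>j\<in>I. congruent_sets (P i) (P j)))"

end

theory Submission
  imports Defs "HOL-Computational_Algebra.Fraction_Field"
begin

text \<open>
  Identify \<open>\<real>\<^bsup>2s\<^esup>\<close> with \<open>\<complex>\<^sup>s\<close> and let the centre of the ball \<open>B\<close> be the origin. The pieces will be the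
  images \<open>f\<^sub>i ` A\<close>, \<open>i \<le> k = m - 1\<close>, of one set \<open>A\<close> under isometries, so \<open>A\<close> has to be such that every
  \<open>y \<in> B\<close> equals \<open>f\<^sub>i x\<close> for exactly one pair \<open>(i, x)\<close> with \<open>x \<in> A\<close>. This is an exact cover problem for
  the bipartite graph that joins \<open>x\<close>, as a possible element of \<open>A\<close>, to its images \<open>f\<^sub>0 x, \<dots>, f\<^sub>k x\<close>, as
  points to be covered. All \<open>f\<^sub>i\<close> but one are rotations about the origin; they alone cannot work, since
  each of them covers the origin by the origin. The last one, \<open>f\<^sub>k\<close>, rotates about another point \<open>p\<close> and
  covers the origin by \<open>c = f\<^sub>k\<^sup>-\<^sup>1 0\<close>. An \<open>x\<close> may be used only if \<open>f\<^sub>k x \<in> B\<close>.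

  In a forest with enough branching an exact cover can be built greedily. A forest is recognised by a
  height for which each vertex has at most one neighbour that is not higher
  (\<open>exact_cover_of_ranked_graph\<close>; infinite descending paths are allowed). The height
  is arithmetic. Let \<open>u\<close> be a transcendental number on the unit circle. As a vector space over \<open>\<rat>(u)\<close>, the
  field \<open>\<complex>\<close> carries an ultrametric norm \<open>\<nu>\<close> with \<open>\<nu> (u x) = 2 \<nu> x\<close> that ignores nonzero rational factors
  (\<open>ex_circle_norm\<close>); the height of a point is the largest \<open>\<nu>\<close> of its coordinates. Each
  rotation multiplies the coordinates in some rational orthogonal frame by powers of \<open>u\<close>. It is an
  isometry for the Euclidean norm, but for \<open>\<nu>\<close> it stretches the first frame vector most
  (\<open>turn_expands\<close>): unless the first frame coordinate of \<open>x\<close> is unusually small, the rotation raises the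
  height and turns \<open>x\<close> towards its own first frame vector, which is in general position to the other
  frames. This is a ping-pong argument: the exceptional \<open>x\<close> are few and are left out of \<open>A\<close>,
  and the remaining graph is a forest (locale \<open>ball_motions\<close>).

  It remains to see that each \<open>y \<noteq> 0\<close> keeps enough candidates \<open>x = f\<^sub>i\<^sup>-\<^sup>1 y\<close>. Such an \<open>x\<close> satisfies
  \<open>f\<^sub>k x \<in> B\<close> as soon as \<open>y\<close> is closer to \<open>f\<^sub>i c\<close> than the radius, which for small \<open>c\<close> follows if \<open>f\<^sub>i c\<close> points
  into the half-space of \<open>y\<close>. The powers of \<open>u\<close> are dense enough to place the
  vectors \<open>f\<^sub>i c\<close> close to \<open>\<plusminus>\<close> points on a trigonometric moment curve, and a hyperplane contains at
  most \<open>2s\<close> of these points, so that \<open>4s + 2\<close> antipodal pairs give each \<open>y\<close> at least \<open>2s + 2\<close> indices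
  (\<open>ex_spread_rotations\<close>). At most \<open>2s - 2\<close> of them are lost because \<open>f\<^sub>i\<^sup>-\<^sup>1\<close> may fail to raise \<open>y\<close>
  (\<open>few_contracting_frames\<close>), and at most one because \<open>f\<^sub>i\<^sup>-\<^sup>1 y\<close> has the same height as \<open>p\<close>.
\<close>

section \<open>Exact covers in graphs with a height\<close>

lemma single_valued_rtrancl_linear:
  assumes "single_valued G" "(a, b) \<in> G\<^sup>*" "(a, c) \<in> G\<^sup>*"
  shows "(b, c) \<in> G\<^sup>* \<or> (c, b) \<in> G\<^sup>*"
  using assms(2,3)
proof (induction rule: rtrancl_induct)
  case (step y z)
  then consider "(y, c) \<in> G\<^sup>*" | "(c, y) \<in> G\<^sup>*" by blast
  then show ?case
  proof cases
    case 1
    then show ?thesis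
      using step(2) assms(1) by (metis converse_rtranclE r_into_rtrancl single_valuedD)
  next
    case 2
    then show ?thesis using step(2) by (meson rtrancl.rtrancl_into_rtrancl)
  qed
qed auto

text \<open>
  Write \<open>g x\<close> for the vertex \<open>x'\<close> below the vertex \<open>y\<close> below \<open>x\<close>, if both exist. Let every \<open>y \<in> Y\<close> select
  one of its upper neighbours, and put \<open>x\<close> into \<open>A\<close> iff it is selected and \<open>g x \<notin> A\<close>; then each \<open>y\<close> is
  covered either by its lower neighbour or by the selected one, and never by both. The rule defines \<open>A\<close>
  only if no infinite descending path \<open>x, g x, g (g x), \<dots>\<close> consists of selected vertices. To ensure this, a
  base point is fixed in every class of vertices whose descending paths eventually merge, and no vertex
  on the descending path of the base point is selected by a \<open>y\<close> that has a lower neighbour. As such a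
  path meets the upper neighbours of \<open>y\<close> at most once, two of them leave a choice.
\<close>

theorem exact_cover_of_ranked_graph:
  fixes f :: "'i \<Rightarrow> 'a \<Rightarrow> 'a" and \<rho> :: "'a \<Rightarrow> real"
  assumes inj: "\<And>i. i \<in> I \<Longrightarrow> inj (f i)"
    and down_left: "\<And>x i j. \<lbrakk>x \<in> L; i \<in> I; j \<in> I; \<rho> (f i x) < \<rho> x; \<rho> (f j x) < \<rho> x\<rbrakk> \<Longrightarrow> i = j"
    and down_right: "\<And>x x' i j. \<lbrakk>x \<in> L; x' \<in> L; i \<in> I; j \<in> I; f i x = f j x';
            \<rho> x \<le> \<rho> (f i x); \<rho> x' \<le> \<rho> (f i x)\<rbrakk> \<Longrightarrow> i = j"
    and up_one: "\<And>y. y \<in> Y \<Longrightarrow> \<exists>x\<in>L. \<exists>i\<in>I. f i x = y \<and> \<rho> y < \<rho> x"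
    and up_two: "\<And>y x i. \<lbrakk>y \<in> Y; x \<in> L; i \<in> I; f i x = y; \<rho> x \<le> \<rho> y\<rbrakk> \<Longrightarrow>
            \<exists>x\<in>L. \<exists>x'\<in>L. x \<noteq> x' \<and> (\<exists>i\<in>I. f i x = y) \<and> (\<exists>i\<in>I. f i x' = y) \<and> \<rho> y < \<rho> x \<and> \<rho> y < \<rho> x'"
  shows "\<exists>A\<subseteq>L. \<forall>y\<in>Y. \<exists>!(i, x). i \<in> I \<and> x \<in> A \<and> f i x = y"
proof -
  define up where "up = (\<lambda>y x. y \<in> Y \<and> x \<in> L \<and> (\<exists>i\<in>I. f i x = y) \<and> \<rho> y < \<rho> x)"
  define low where "low = (\<lambda>y x. y \<in> Y \<and> x \<in> L \<and> (\<exists>i\<in>I. f i x = y) \<and> \<rho> x \<le> \<rho> y)"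
  have up_unique: "y = y'" if "up y x" "up y' x" for x y y'
    using that down_left unfolding up_def by metis
  have low_unique: "x = x'" if "low y x" "low y x'" for x x' y
    using that down_right inj unfolding low_def by (metis injD)
  define G where "G = {(x, x'). \<exists>y. up y x \<and> low y x'}"
  have sv: "single_valued G"
    unfolding single_valued_def G_def using up_unique low_unique by blast
  have G_less: "\<rho> x' < \<rho> x" if "(x, x') \<in> G" for x x'
    using that unfolding G_def up_def low_def by force
  have G_le: "\<rho> x' \<le> \<rho> x" if "(x, x') \<in> G\<^sup>*" for x x'
    using that by (induction rule: rtrancl_induct) (auto dest: G_less)
  define joined where "joined = (\<lambda>x z. \<exists>w. (x, w) \<in> G\<^sup>* \<and> (z, w) \<in> G\<^sup>*)"
  have joined_sym: "joined x z \<Longrightarrow> joined z x" for x z unfolding joined_def by blast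
  have joined_trans: "joined x z \<Longrightarrow> joined z t \<Longrightarrow> joined x t" for x z t
    unfolding joined_def using single_valued_rtrancl_linear[OF sv] by (meson rtrancl_trans)
  define base where "base = (\<lambda>x. SOME b. joined x b)"
  have base: "joined x (base x)" for x
    unfolding base_def by (rule someI[of _ x]) (auto simp: joined_def)
  have base_cong: "base x = base z" if "joined x z" for x z
  proof -
    have "joined x = joined z" using that joined_sym joined_trans by blast
    then show ?thesis by (simp add: base_def)
  qed
  have base_G: "base x = base z" if "(x, z) \<in> G\<^sup>*" for x z
    using that by (intro base_cong) (auto simp: joined_def)
  define ray where "ray = (\<lambda>x. {w. (base x, w) \<in> G\<^sup>*})"
  have ray_G: "ray x = ray z" if "(x, z) \<in> G\<^sup>*" for x z
    using base_G[OF that] by (simp add: ray_def)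
  \<comment> \<open>A descending path returns to no height, so it passes at most one upper neighbour of a given vertex.\<close>
  have ray_once: "x1 = x2" if "up y x1" "up y x2" "low y x'" "x1 \<in> ray z" "x2 \<in> ray z" for y x1 x2 x' z
  proof -
    have *: "a = b" if ab: "(a, b) \<in> G\<^sup>*" and "up y a" "up y b" for a b
    proof (rule ccontr)
      assume "a \<noteq> b"
      then obtain c where c: "(a, c) \<in> G" "(c, b) \<in> G\<^sup>*" using ab by (metis converse_rtranclE)
      have "(a, x') \<in> G" using \<open>up y a\<close> \<open>low y x'\<close> by (auto simp: G_def)
      then have "c = x'" using c sv by (auto dest: single_valuedD)
      moreover have "(b, x') \<in> G" using \<open>up y b\<close> \<open>low y x'\<close> by (auto simp: G_def)
      ultimately show False using G_le[OF c(2)] G_less[of b x'] by auto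
    qed
    show ?thesis
      using single_valued_rtrancl_linear[OF sv, of "base z" x1 x2] that * unfolding ray_def by blast
  qed
  have "\<exists>x. up y x \<and> (\<forall>x'. low y x' \<longrightarrow> x \<notin> ray x')" if y: "y \<in> Y" for y
  proof (cases "\<exists>x'. low y x'")
    case True
    then obtain x' where x': "low y x'" by blast
    then obtain x1 x2 where "up y x1" "up y x2" "x1 \<noteq> x2"
      using up_two[of y x'] unfolding low_def up_def by blast
    then show ?thesis using ray_once x' low_unique by metis
  next
    case False
    then show ?thesis using up_one[OF y] y unfolding up_def by blast
  qed
  then obtain c where c: "\<And>y. y \<in> Y \<Longrightarrow> up y (c y)" "\<And>y x'. low y x' \<Longrightarrow> c y \<notin> ray x'"
    unfolding low_def by metis
  \<comment> \<open>Every infinite descending path of selected vertices would run into the path of its base point.\<close>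
  define chosen where "chosen = (\<lambda>x. \<exists>y. up y x \<and> c y = x)"
  define R where "R = {(x', x). (x, x') \<in> G \<and> chosen x}"
  have "wf R"
    unfolding wf_iff_no_infinite_down_chain
  proof
    assume "\<exists>s. \<forall>i. (s (Suc i), s i) \<in> R"
    then obtain s where s: "\<And>i. (s i, s (Suc i)) \<in> G" "\<And>i. chosen (s i)" by (auto simp: R_def)
    obtain w where w: "(s 0, w) \<in> G\<^sup>*" "(base (s 0), w) \<in> G\<^sup>*"
      using base[of "s 0"] unfolding joined_def by blast
    have "\<exists>n. w = s n" using w(1)
      by (induction rule: rtrancl_induct) (use s(1) sv in \<open>auto dest: single_valuedD\<close>)
    then obtain n where n: "w = s n" by blast
    have s0: "(s 0, s i) \<in> G\<^sup>*" for i
      by (induction i) (auto intro: rtrancl_into_rtrancl s(1))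
    have "s n \<in> ray (s (Suc n))"
      using ray_G[OF s0[of "Suc n"]] w n by (auto simp: ray_def)
    moreover obtain y where "up y (s n)" "low y (s (Suc n))"
      using s(1)[of n] by (auto simp: G_def)
    moreover from this s(2)[of n] have "c y = s n" using up_unique by (auto simp: chosen_def)
    ultimately show False using c(2) by metis
  qed
  define A where "A = {x. wfrec R (\<lambda>P x. chosen x \<and> \<not> (\<exists>x'. (x, x') \<in> G \<and> P x')) x}"
  have A: "x \<in> A \<longleftrightarrow> chosen x \<and> \<not> (\<exists>x'. (x, x') \<in> G \<and> x' \<in> A)" for x
    unfolding A_def mem_Collect_eq
    by (subst wfrec[OF \<open>wf R\<close>]) (auto simp: cut_def R_def)
  have covered: "\<exists>!x. x \<in> A \<and> (up y x \<or> low y x)" if y: "y \<in> Y" for y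
  proof -
    have up_A: "x \<in> A \<longleftrightarrow> x = c y \<and> \<not> (\<exists>x'. low y x' \<and> x' \<in> A)" if "up y x" for x
    proof -
      have "chosen x \<longleftrightarrow> x = c y" using that up_unique c(1)[OF y] by (auto simp: chosen_def)
      moreover have "(x, x') \<in> G \<longleftrightarrow> low y x'" for x'
        using that up_unique by (auto simp: G_def)
      ultimately show ?thesis using A[of x] by blast
    qed
    show ?thesis
    proof (cases "\<exists>x'. low y x' \<and> x' \<in> A")
      case True
      then show ?thesis using up_A low_unique by blast
    next
      case False
      then show ?thesis using up_A c(1)[OF y] by (intro ex1I[of _ "c y"]) blast+
    qed
  qed
  have "A \<subseteq> L"
    using A by (auto simp: chosen_def up_def)
  have nbr: "up y x \<or> low y x \<longleftrightarrow> x \<in> L \<and> (\<exists>i\<in>I. f i x = y)" if "y \<in> Y" for x y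
    using that linorder_not_le[of "\<rho> x" "\<rho> y"] unfolding up_def low_def by blast
  have index_unique: "i = j" if "x \<in> L" "i \<in> I" "j \<in> I" "f i x = f j x" for x i j
    using down_left[of x i j] down_right[of x x i j] that by (metis linorder_not_le)
  have "\<exists>!(i, x). i \<in> I \<and> x \<in> A \<and> f i x = y" if y: "y \<in> Y" for y
  proof -
    obtain x where x: "x \<in> A" "up y x \<or> low y x"
      using ex1_implies_ex[OF covered[OF y]] by blast
    have x_unique: "z = x" if "z \<in> A" "up y z \<or> low y z" for z
      using covered[OF y] that x by (metis (no_types, lifting))
    obtain i where i: "i \<in> I" "f i x = y" using nbr[OF y, of x] x by blast
    show ?thesis
    proof (rule ex1I[of _ "(i, x)"])
      fix p assume p: "case p of (j, z) \<Rightarrow> j \<in> I \<and> z \<in> A \<and> f j z = y"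
      obtain j z where [simp]: "p = (j, z)" by fastforce
      have "z = x" using p nbr[OF y, of z] \<open>A \<subseteq> L\<close> by (intro x_unique) auto
      then show "p = (i, x)" using p i(1) i(2)[symmetric] x(1) index_unique[of x i j] \<open>A \<subseteq> L\<close> by auto
    qed (use i x in auto)
  qed
  then show ?thesis using \<open>A \<subseteq> L\<close> by blast
qed

section \<open>A non-archimedean norm on the complex numbers\<close>

definition int_poly_at :: "complex \<Rightarrow> int poly \<Rightarrow> complex" where
  "int_poly_at u p = poly (map_poly of_int p) u"

definition transcendental :: "complex \<Rightarrow> bool" where
  "transcendental u \<longleftrightarrow> (\<forall>p. int_poly_at u p = 0 \<longrightarrow> p = 0)"

lemma int_poly_at_pCons: "int_poly_at u (pCons a p) = of_int a + u * int_poly_at u p"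
  by (cases "pCons a p = 0") (auto simp: int_poly_at_def map_poly_pCons)

lemma int_poly_at_0 [simp]: "int_poly_at u 0 = 0"
  by (simp add: int_poly_at_def)

lemma int_poly_at_1 [simp]: "int_poly_at u 1 = 1"
  by (simp add: int_poly_at_def)

lemma int_poly_at_add: "int_poly_at u (p + q) = int_poly_at u p + int_poly_at u q"
  by (induction p q rule: poly_induct2) (auto simp: int_poly_at_pCons algebra_simps)

lemma int_poly_at_smult: "int_poly_at u (smult a p) = of_int a * int_poly_at u p"
  by (induction p) (auto simp: int_poly_at_pCons algebra_simps)

lemma int_poly_at_mult: "int_poly_at u (p * q) = int_poly_at u p * int_poly_at u q"
  by (induction p) (auto simp: int_poly_at_pCons int_poly_at_add int_poly_at_smult algebra_simps)

lemma ex_transcendental_on_circle: "\<exists>u. cmod u = 1 \<and> transcendental u"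
proof -
  let ?R = "\<Union>p\<in>UNIV - {0::int poly}. {z. int_poly_at z p = 0}"
  have "countable (range (Poly :: int list \<Rightarrow> int poly))" by auto
  moreover have "range (Poly :: int list \<Rightarrow> int poly) = UNIV"
    by (metis Poly_coeffs surj_def)
  ultimately have cp: "countable (UNIV :: int poly set)" by simp
  have "finite {z. int_poly_at z p = 0}" if "p \<noteq> 0" for p
  proof -
    have "map_poly (of_int::int\<Rightarrow>complex) p \<noteq> 0" using that by (subst map_poly_eq_0_iff) auto
    then show ?thesis unfolding int_poly_at_def by (rule poly_roots_finite)
  qed
  then have "countable ?R"
    by (intro countable_UN countable_subset[OF _ cp]) (auto intro: countable_finite)
  moreover have "uncountable (cis ` {0<..<pi})"
  proof -
    have "inj_on cis {0<..<pi}"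
      by (rule inj_onI) (metis cis.sel(1) cos_inj_pi greaterThanLessThan_iff less_imp_le)
    then show ?thesis
      using uncountable_open_interval[of 0 pi] countable_image_inj_eq by (metis pi_gt_zero)
  qed
  ultimately obtain z where "z \<in> cis ` {0<..<pi}" "z \<notin> ?R"
    by (meson countable_subset subsetI)
  then show ?thesis unfolding transcendental_def by (intro exI[of _ z]) auto
qed

text \<open>
  Evaluation at \<open>u\<close> identifies the field \<open>int poly fract\<close> with \<open>\<rat>(u)\<close>; the choice operator picks the common
  value of all representations of a fraction.
\<close>

definition fract_at :: "complex \<Rightarrow> int poly fract \<Rightarrow> complex" where
  "fract_at u x = (SOME z. \<exists>p q. q \<noteq> 0 \<and> x = Fract p q \<and> z = int_poly_at u p / int_poly_at u q)"

definition exp_degree :: "int poly \<Rightarrow> real" where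
  "exp_degree p = (if p = 0 then 0 else 2 ^ degree p)"

text \<open>
  The absolute value of \<open>\<rat>(u)\<close> at infinity: two to the power of the degree of a rational function.
\<close>

definition fract_val :: "int poly fract \<Rightarrow> real" where
  "fract_val x = (SOME z. \<exists>p q. q \<noteq> 0 \<and> x = Fract p q \<and> z = exp_degree p / exp_degree q)"

lemma exp_degree_mult: "exp_degree (p * q) = exp_degree p * exp_degree q"
  by (auto simp: exp_degree_def degree_mult_eq power_add)

lemma exp_degree_add: "exp_degree (p + q) \<le> max (exp_degree p) (exp_degree q)"
proof (cases "p = 0 \<or> q = 0 \<or> p + q = 0")
  case False
  have "degree (p + q) \<le> degree p \<or> degree (p + q) \<le> degree q"
    using degree_add_le_max[of p q] by linarith
  then show ?thesis using False by (auto simp: exp_degree_def le_max_iff_disj)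
qed (auto simp: exp_degree_def le_max_iff_disj)

lemma exp_degree_nonneg: "exp_degree p \<ge> 0" and exp_degree_eq_0: "exp_degree p = 0 \<longleftrightarrow> p = 0"
  by (auto simp: exp_degree_def)

lemma fract_at_Fract:
  assumes "transcendental u" "q \<noteq> 0"
  shows "fract_at u (Fract p q) = int_poly_at u p / int_poly_at u q"
  unfolding fract_at_def
proof (rule some_equality)
  fix z assume "\<exists>p' q'. q' \<noteq> 0 \<and> Fract p q = Fract p' q' \<and> z = int_poly_at u p' / int_poly_at u q'"
  then obtain p' q' where *: "q' \<noteq> 0" "Fract p q = Fract p' q'" "z = int_poly_at u p' / int_poly_at u q'" by blast
  then have "p * q' = p' * q" using assms by (simp add: eq_fract)
  then have "int_poly_at u p * int_poly_at u q' = int_poly_at u p' * int_poly_at u q"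
    by (metis int_poly_at_mult)
  then show "z = int_poly_at u p / int_poly_at u q"
    using * assms unfolding transcendental_def by (metis frac_eq_eq)
qed (use assms in auto)

lemma fract_val_Fract:
  assumes "q \<noteq> 0"
  shows "fract_val (Fract p q) = exp_degree p / exp_degree q"
  unfolding fract_val_def
proof (rule some_equality)
  fix z assume "\<exists>p' q'. q' \<noteq> 0 \<and> Fract p q = Fract p' q' \<and> z = exp_degree p' / exp_degree q'"
  then obtain p' q' where *: "q' \<noteq> 0" "Fract p q = Fract p' q'" "z = exp_degree p' / exp_degree q'" by blast
  then have "p * q' = p' * q" using assms by (simp add: eq_fract)
  then have "exp_degree p * exp_degree q' = exp_degree p' * exp_degree q"
    by (metis exp_degree_mult)
  then show "z = exp_degree p / exp_degree q"
    using * assms by (auto simp: exp_degree_eq_0 frac_eq_eq)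
qed (use assms in auto)

lemma fract_val_mult: "fract_val (x * y) = fract_val x * fract_val y"
  by (cases x; cases y) (simp add: fract_val_Fract exp_degree_mult)

lemma fract_val_add: "fract_val (x + y) \<le> max (fract_val x) (fract_val y)"
proof (cases x; cases y)
  fix a b c d assume *: "x = Fract a b" "b \<noteq> 0" "y = Fract c d" "d \<noteq> 0"
  have p: "exp_degree b > 0" "exp_degree d > 0"
    using * by (auto simp: exp_degree_def)
  have "fract_val (x + y) = exp_degree (a * d + c * b) / (exp_degree b * exp_degree d)"
    using * by (simp add: fract_val_Fract exp_degree_mult)
  also have "\<dots> \<le> max (exp_degree a * exp_degree d) (exp_degree c * exp_degree b) / (exp_degree b * exp_degree d)"
    using p exp_degree_add[of "a * d" "c * b"] by (intro divide_right_mono) (auto simp: exp_degree_mult)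
  also have "\<dots> = max (fract_val x) (fract_val y)"
    using p * by (simp add: fract_val_Fract max_divide_distrib_right)
  finally show ?thesis .
qed

lemma fract_val_nonneg: "fract_val x \<ge> 0"
  by (cases x) (simp add: fract_val_Fract exp_degree_nonneg)

lemma fract_val_eq_0: "fract_val x = 0 \<longleftrightarrow> x = 0"
  by (cases x) (auto simp: fract_val_Fract exp_degree_eq_0 Zero_fract_def eq_fract)

text \<open>
  The number \<open>u\<close> acts isometrically on \<open>\<complex>\<close> for the usual absolute value, but expands by the factor \<open>2\<close> for
  the additive norm \<open>\<nu>\<close>. The norm is not required to be multiplicative: invariance under rational factors
  is all that matrices with rational entries need.
\<close>

locale circle_norm =
  fixes u :: complex and \<nu> :: "complex \<Rightarrow> real"
  assumes norm_u: "cmod u = 1"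
    and nonneg: "\<nu> x \<ge> 0"
    and eq_0_iff [simp]: "\<nu> x = 0 \<longleftrightarrow> x = 0"
    and one [simp]: "\<nu> 1 = 1"
    and add_le: "\<nu> (x + y) \<le> max (\<nu> x) (\<nu> y)"
    and rat_mult: "q \<noteq> 0 \<Longrightarrow> \<nu> (of_rat q * x) = \<nu> x"
    and u_mult: "\<nu> (u * x) = 2 * \<nu> x"

text \<open>
  Over a basis of \<open>\<complex>\<close> as a vector space over \<open>\<rat>(u)\<close>, take the maximum of the values of the coordinates and
  scale it to be \<open>1\<close> at \<open>1\<close>. Multiplication by an element of \<open>\<rat>(u)\<close> then multiplies the norm by its value,
  which is \<open>1\<close> for rational numbers and \<open>2\<close> for \<open>u\<close>.
\<close>

theorem ex_circle_norm: "\<exists>u \<nu>. circle_norm u \<nu>"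
proof -
  obtain u where u: "cmod u = 1" "transcendental u"
    using ex_transcendental_on_circle by blast
  define scale where "scale = (\<lambda>x z. fract_at u x * z)"
  have nz: "int_poly_at u p \<noteq> 0" if "p \<noteq> 0" for p
    using that u(2) by (auto simp: transcendental_def)
  have at_add: "fract_at u (x + y) = fract_at u x + fract_at u y" for x y
    by (cases x; cases y) (simp add: fract_at_Fract[OF u(2)] int_poly_at_add int_poly_at_mult nz field_simps)
  have at_mult: "fract_at u (x * y) = fract_at u x * fract_at u y" for x y
    by (cases x; cases y) (simp add: fract_at_Fract[OF u(2)] int_poly_at_mult)
  have at_1: "fract_at u 1 = 1"
    by (simp add: One_fract_def fract_at_Fract[OF u(2)])
  interpret V: vector_space scale
    by unfold_locales (auto simp: scale_def at_add at_mult at_1 algebra_simps)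
  obtain B where B: "V.independent B" "V.span B = UNIV"
    by (metis V.maximal_independent_subset[of UNIV] UNIV_I subsetI subset_antisym)
  define rep where "rep = V.representation B"
  define S where "S = (\<lambda>z. {b. rep z b \<noteq> 0})"
  define \<mu> where "\<mu> = (\<lambda>z. Max (insert 0 ((\<lambda>b. fract_val (rep z b)) ` S z)))"
  have fin: "finite (S z)" for z
    unfolding S_def rep_def by (rule V.finite_representation)
  have le_\<mu>: "fract_val (rep z b) \<le> \<mu> z" for z b
    unfolding \<mu>_def using fin[of z]
    by (cases "rep z b = 0") (auto intro!: Max_ge simp: S_def fract_val_eq_0[THEN iffD2])
  have \<mu>_le: "\<mu> z \<le> t" if "t \<ge> 0" "\<And>b. fract_val (rep z b) \<le> t" for z t
    unfolding \<mu>_def using fin[of z] that by (subst Max_le_iff) auto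
  have \<mu>_nonneg: "\<mu> z \<ge> 0" for z
    unfolding \<mu>_def using fin[of z] by (intro Max_ge) auto
  have rep_add: "rep (x + y) b = rep x b + rep y b" for x y b
    unfolding rep_def using B by (subst V.representation_add) auto
  have rep_scale: "rep (scale c x) b = c * rep x b" for c x b
    unfolding rep_def using B by (subst V.representation_scale) auto
  have rep_0: "(\<forall>b. rep x b = 0) \<longleftrightarrow> x = 0" for x
  proof
    assume "\<forall>b. rep x b = 0"
    then show "x = 0" using V.sum_nonzero_representation_eq[of B x] B by (simp add: rep_def)
  qed (simp add: rep_def V.representation_zero)
  have \<mu>_add: "\<mu> (x + y) \<le> max (\<mu> x) (\<mu> y)" for x y
  proof (rule \<mu>_le)
    fix b
    have "fract_val (rep (x + y) b) \<le> max (fract_val (rep x b)) (fract_val (rep y b))"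
      by (simp add: rep_add fract_val_add)
    also have "\<dots> \<le> max (\<mu> x) (\<mu> y)" using le_\<mu> by (intro max.mono) auto
    finally show "fract_val (rep (x + y) b) \<le> max (\<mu> x) (\<mu> y)" .
  qed (simp add: \<mu>_nonneg le_max_iff_disj)
  have \<mu>_scale_le: "\<mu> (scale c x) \<le> fract_val c * \<mu> x" for c x
    by (rule \<mu>_le) (auto simp: rep_scale fract_val_mult fract_val_nonneg \<mu>_nonneg intro!: mult_left_mono le_\<mu>)
  have val_1: "fract_val 1 = 1" by (simp add: One_fract_def fract_val_Fract exp_degree_def)
  have \<mu>_scale: "\<mu> (scale c x) = fract_val c * \<mu> x" for c x
  proof (cases "c = 0")
    case True
    then show ?thesis using \<mu>_scale_le[of c x] \<mu>_nonneg[of "scale c x"] by (simp add: fract_val_eq_0[THEN iffD2])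
  next
    case False
    have "fract_val c * \<mu> x = fract_val c * \<mu> (scale (inverse c) (scale c x))"
      using False by (simp add: V.scale_scale)
    also have "\<dots> \<le> fract_val c * (fract_val (inverse c) * \<mu> (scale c x))"
      by (intro mult_left_mono \<mu>_scale_le fract_val_nonneg)
    also have "\<dots> = fract_val (c * inverse c) * \<mu> (scale c x)" by (simp only: fract_val_mult mult.assoc)
    also have "\<dots> = \<mu> (scale c x)" using False by (simp add: val_1)
    finally show ?thesis using \<mu>_scale_le[of c x] by linarith
  qed
  have \<mu>_0: "\<mu> x = 0 \<longleftrightarrow> x = 0" for x
  proof
    assume "\<mu> x = 0"
    then have "fract_val (rep x b) = 0" for b using le_\<mu>[of x b] fract_val_nonneg[of "rep x b"] by linarith
    then show "x = 0" by (simp add: fract_val_eq_0 rep_0[symmetric])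
  next
    assume "x = 0"
    then have "\<And>b. rep x b = 0" using rep_0 by blast
    then show "\<mu> x = 0" by (simp add: \<mu>_def S_def)
  qed
  have "circle_norm u (\<lambda>x. \<mu> x / \<mu> 1)"
  proof
    fix q :: rat and x assume q: "q \<noteq> 0"
    obtain a b where ab: "q = Rat.Fract a b" "b > 0" by (cases q)
    have a: "a \<noteq> 0" using ab q by (auto simp: Rat.Zero_rat_def eq_rat)
    have "of_rat q = fract_at u (Fract [:a:] [:b:])"
      using ab by (simp add: fract_at_Fract[OF u(2)] int_poly_at_pCons of_rat_rat)
    then have "of_rat q * x = scale (Fract [:a:] [:b:]) x" by (simp add: scale_def)
    moreover have "fract_val (Fract [:a:] [:b:]) = 1"
      using a ab by (simp add: fract_val_Fract exp_degree_def)
    ultimately show "\<mu> (of_rat q * x) / \<mu> 1 = \<mu> x / \<mu> 1" by (simp add: \<mu>_scale)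
  next
    fix x
    have "u * x = scale (Fract [:0, 1:] 1) x"
      by (simp add: scale_def fract_at_Fract[OF u(2)] int_poly_at_pCons)
    moreover have "fract_val (Fract [:0, 1:] 1) = 2" by (simp add: fract_val_Fract exp_degree_def)
    ultimately show "\<mu> (u * x) / \<mu> 1 = 2 * (\<mu> x / \<mu> 1)" by (simp add: \<mu>_scale)
  next
    fix x y
    show "\<mu> (x + y) / \<mu> 1 \<le> max (\<mu> x / \<mu> 1) (\<mu> y / \<mu> 1)"
      using divide_right_mono[OF \<mu>_add[of x y] \<mu>_nonneg[of 1]] \<mu>_nonneg[of 1]
      by (simp add: max_divide_distrib_right)
  qed (auto simp: u \<mu>_0 \<mu>_nonneg)
  then show ?thesis by blast
qed

section \<open>Rotations with a rational frame\<close>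

definition rat_apply :: "nat \<Rightarrow> (nat \<Rightarrow> nat \<Rightarrow> rat) \<Rightarrow> (nat \<Rightarrow> complex) \<Rightarrow> nat \<Rightarrow> complex" where
  "rat_apply s Q z l = (\<Sum>j<s. of_rat (Q l j) * z j)"

text \<open>
  Symmetric orthogonal matrices with rational entries: the rows form an orthonormal basis, and by
  symmetry the same matrix leads into the frame and back.
\<close>

definition rat_frame :: "nat \<Rightarrow> (nat \<Rightarrow> nat \<Rightarrow> rat) \<Rightarrow> bool" where
  "rat_frame s Q \<longleftrightarrow> (\<forall>l<s. \<forall>j<s. Q l j = Q j l) \<and>
     (\<forall>l<s. \<forall>k<s. (\<Sum>j<s. Q l j * Q j k) = (if l = k then 1 else 0))"

text \<open>
  Multiply the coordinate number \<open>j\<close> in the frame \<open>Q\<close> by \<open>u\<^bsup>E j\<^esup>\<close>, up to a rational factor \<open>\<sigma>\<close>, which will be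
  a sign.
\<close>

definition turn :: "complex \<Rightarrow> nat \<Rightarrow> (nat \<Rightarrow> nat \<Rightarrow> rat) \<Rightarrow> (nat \<Rightarrow> int) \<Rightarrow> rat \<Rightarrow> (nat \<Rightarrow> complex) \<Rightarrow> nat \<Rightarrow> complex" where
  "turn u s Q E \<sigma> z l = of_rat \<sigma> * rat_apply s Q (\<lambda>j. u powi E j * rat_apply s Q z j) l"

lemma rat_apply_rat_apply:
  "rat_apply s Q (rat_apply s R z) l = (\<Sum>j<s. of_rat (\<Sum>i<s. Q l i * R i j) * z j)"
proof -
  have "rat_apply s Q (rat_apply s R z) l = (\<Sum>i<s. \<Sum>j<s. of_rat (Q l i * R i j) * z j)"
    by (simp add: rat_apply_def sum_distrib_left of_rat_mult mult_ac)
  also have "\<dots> = (\<Sum>j<s. \<Sum>i<s. of_rat (Q l i * R i j) * z j)"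
    by (rule sum.swap)
  finally show ?thesis by (simp add: of_rat_sum sum_distrib_right)
qed

lemma rat_apply_cong: "(\<And>j. j < s \<Longrightarrow> z j = w j) \<Longrightarrow> rat_apply s Q z l = rat_apply s Q w l"
  by (auto simp: rat_apply_def)

lemma rat_apply_frame_twice:
  assumes "rat_frame s Q" "l < s"
  shows "rat_apply s Q (rat_apply s Q z) l = z l"
proof -
  have "(\<Sum>i<s. Q l i * Q i j) = (if l = j then 1 else 0)" if "j < s" for j
    using assms that unfolding rat_frame_def by blast
  then have "rat_apply s Q (rat_apply s Q z) l = (\<Sum>j<s. of_rat (if l = j then 1 else 0) * z j)"
    unfolding rat_apply_rat_apply by (intro sum.cong) (simp_all only: lessThan_iff)
  also have "\<dots> = (\<Sum>j<s. if l = j then z j else 0)" by (intro sum.cong) auto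
  finally show ?thesis using assms by simp
qed

lemma rat_apply_scale: "rat_apply s Q (\<lambda>j. c * z j) l = c * rat_apply s Q z l"
  by (simp add: rat_apply_def sum_distrib_left mult_ac)

lemma rat_apply_add: "rat_apply s Q (\<lambda>j. z j + w j) l = rat_apply s Q z l + rat_apply s Q w l"
  by (simp add: rat_apply_def sum.distrib algebra_simps)

lemma rat_apply_diff: "rat_apply s Q (\<lambda>j. z j - w j) l = rat_apply s Q z l - rat_apply s Q w l"
  by (simp add: rat_apply_def sum_subtractf algebra_simps)

text \<open>
  The matrix is real, symmetric and squares to the identity, so that \<open>\<parallel>Q z\<parallel>\<^sup>2 = \<langle>z, Q Q z\<rangle> = \<parallel>z\<parallel>\<^sup>2\<close>.
\<close>

lemma rat_apply_norm:
  assumes "rat_frame s Q"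
  shows "(\<Sum>l<s. (cmod (rat_apply s Q z l))\<^sup>2) = (\<Sum>l<s. (cmod (z l))\<^sup>2)"
proof -
  have "complex_of_real (\<Sum>l<s. (cmod (rat_apply s Q z l))\<^sup>2)
      = (\<Sum>l<s. rat_apply s Q z l * rat_apply s Q (\<lambda>j. cnj (z j)) l)"
  proof -
    have "cnj (of_rat r) = of_rat r" for r by (cases r) (simp add: of_rat_rat)
    then have "rat_apply s Q (\<lambda>j. cnj (z j)) l = cnj (rat_apply s Q z l)" for l
      by (simp add: rat_apply_def)
    then show ?thesis by (simp only: of_real_sum complex_norm_square)
  qed
  also have "\<dots> = (\<Sum>l<s. \<Sum>j<s. of_rat (Q l j) * cnj (z j) * rat_apply s Q z l)"
    by (simp add: rat_apply_def[of s Q "\<lambda>j. cnj (z j)"] sum_distrib_left mult_ac)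
  also have "\<dots> = (\<Sum>j<s. \<Sum>l<s. of_rat (Q l j) * cnj (z j) * rat_apply s Q z l)"
    by (rule sum.swap)
  also have "\<dots> = (\<Sum>j<s. cnj (z j) * rat_apply s Q (rat_apply s Q z) j)"
    unfolding rat_apply_def[of s Q "rat_apply s Q z"] sum_distrib_left using assms
    by (intro sum.cong refl) (auto simp: rat_frame_def mult_ac)
  also have "\<dots> = complex_of_real (\<Sum>l<s. (cmod (z l))\<^sup>2)"
    unfolding of_real_sum complex_norm_square using assms
    by (intro sum.cong) (simp_all add: rat_apply_frame_twice mult.commute)
  finally show ?thesis by (simp only: of_real_eq_iff)
qed

context circle_norm
begin

lemma zero [simp]: "\<nu> 0 = 0" by simp

lemma pos: "x \<noteq> 0 \<Longrightarrow> \<nu> x > 0"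
  using nonneg[of x] by (simp add: less_le)

lemma u_nz: "u \<noteq> 0" using norm_u by auto

lemma minus [simp]: "\<nu> (- x) = \<nu> x"
  using rat_mult[of "-1" x] by simp

lemma diff_le: "\<nu> (x - y) \<le> max (\<nu> x) (\<nu> y)"
  using add_le[of x "-y"] by simp

lemma rat_mult_le: "\<nu> (of_rat q * x) \<le> \<nu> x"
  using rat_mult[of q x] nonneg[of x] by (cases "q = 0") auto

lemma add_dominant: "\<nu> y < \<nu> x \<Longrightarrow> \<nu> (x + y) = \<nu> x"
  using add_le[of x y] diff_le[of "x + y" y] by (auto simp: max_def split: if_splits)

lemma sum_less:
  assumes "finite S" "t > 0" "\<And>j. j \<in> S \<Longrightarrow> \<nu> (g j) < t"
  shows "\<nu> (\<Sum>j\<in>S. g j) < t"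
  using assms
proof (induction S)
  case (insert a S)
  then show ?case using add_le[of "g a" "sum g S"] by fastforce
qed auto

lemma sum_le:
  assumes "finite S" "t \<ge> 0" "\<And>j. j \<in> S \<Longrightarrow> \<nu> (g j) \<le> t"
  shows "\<nu> (\<Sum>j\<in>S. g j) \<le> t"
  using assms
proof (induction S)
  case (insert a S)
  then show ?case using add_le[of "g a" "sum g S"] by fastforce
qed auto

lemma sum_dominant:
  assumes "finite S" "a \<in> S" "q a \<noteq> 0" "\<And>j. j \<in> S \<Longrightarrow> j \<noteq> a \<Longrightarrow> \<nu> (g j) < \<nu> (g a)" "\<nu> (g a) > 0"
  shows "\<nu> (\<Sum>j\<in>S. of_rat (q j) * g j) = \<nu> (g a)"
proof -
  have "\<nu> (\<Sum>j\<in>S-{a}. of_rat (q j) * g j) < \<nu> (g a)"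
    using assms by (intro sum_less) (auto intro: le_less_trans[OF rat_mult_le])
  then show ?thesis
    using assms by (subst sum.remove[of S a]) (auto simp: add_dominant rat_mult)
qed

lemma u_powi: "\<nu> (u powi n * x) = 2 powi n * \<nu> x"
proof -
  have nat: "\<nu> (u ^ m * x) = 2 ^ m * \<nu> x" for m x
    by (induction m) (auto simp: mult.assoc u_mult)
  show ?thesis
  proof (cases "n \<ge> 0")
    case True
    then show ?thesis by (simp add: power_int_def nat)
  next
    case False
    define m where "m = nat (- n)"
    have "\<nu> x = \<nu> (u ^ m * (inverse (u ^ m) * x))" using u_nz by (simp flip: mult.assoc)
    also have "\<dots> = 2 ^ m * \<nu> (inverse (u ^ m) * x)" by (rule nat)
    finally have "\<nu> (inverse (u ^ m) * x) = inverse (2 ^ m) * \<nu> x" by simp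
    then show ?thesis using False by (simp add: power_int_def m_def power_inverse power_one_over inverse_eq_divide)
  qed
qed

definition vnorm :: "nat \<Rightarrow> (nat \<Rightarrow> complex) \<Rightarrow> real" where
  "vnorm s z = Max (insert 0 ((\<lambda>l. \<nu> (z l)) ` {..<s}))"

lemma vnorm_ge: "l < s \<Longrightarrow> \<nu> (z l) \<le> vnorm s z"
  unfolding vnorm_def by (intro Max_ge) auto

lemma vnorm_nonneg: "vnorm s z \<ge> 0"
  unfolding vnorm_def by (intro Max_ge) auto

lemma vnorm_le: "t \<ge> 0 \<Longrightarrow> (\<And>l. l < s \<Longrightarrow> \<nu> (z l) \<le> t) \<Longrightarrow> vnorm s z \<le> t"
  unfolding vnorm_def by (subst Max_le_iff) auto

lemma vnorm_attained: "vnorm s z > 0 \<Longrightarrow> \<exists>l<s. \<nu> (z l) = vnorm s z"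
  using Max_in[of "insert 0 ((\<lambda>l. \<nu> (z l)) ` {..<s})"] by (auto simp: vnorm_def)

lemma vnorm_eq_0: "vnorm s z = 0 \<longleftrightarrow> (\<forall>l<s. z l = 0)"
proof
  assume 0: "vnorm s z = 0"
  show "\<forall>l<s. z l = 0"
  proof (intro allI impI)
    fix l assume "l < s"
    then have "\<nu> (z l) \<le> 0" using vnorm_ge[of l s z] 0 by simp
    then show "z l = 0" using pos[of "z l"] by force
  qed
next
  assume *: "\<forall>l<s. z l = 0"
  have "vnorm s z \<le> 0" by (rule vnorm_le) (use * in auto)
  then show "vnorm s z = 0" using vnorm_nonneg[of s z] by simp
qed

lemma vnorm_cong: "(\<And>l. l < s \<Longrightarrow> z l = w l) \<Longrightarrow> vnorm s z = vnorm s w"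
  unfolding vnorm_def by (intro arg_cong[where f = Max] arg_cong[where f = "insert 0"] image_cong) auto

lemma vnorm_add_le: "vnorm s (\<lambda>l. z l + w l) \<le> max (vnorm s z) (vnorm s w)"
proof (rule vnorm_le)
  fix l assume "l < s"
  then show "\<nu> (z l + w l) \<le> max (vnorm s z) (vnorm s w)"
    using add_le[of "z l" "w l"] vnorm_ge[of l s z] vnorm_ge[of l s w] by linarith
qed (simp add: vnorm_nonneg le_max_iff_disj)

lemma vnorm_minus: "vnorm s (\<lambda>l. - z l) = vnorm s z"
  by (simp add: vnorm_def)

lemma vnorm_add_dominant:
  assumes "vnorm s w < vnorm s z"
  shows "vnorm s (\<lambda>l. z l + w l) = vnorm s z"
proof -
  have "vnorm s z \<le> max (vnorm s (\<lambda>l. z l + w l)) (vnorm s (\<lambda>l. - w l))"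
    using vnorm_add_le[of s "\<lambda>l. z l + w l" "\<lambda>l. - w l"] by simp
  then show ?thesis using assms vnorm_add_le[of s z w] by (auto simp: vnorm_minus)
qed

lemma rat_apply_le: "\<nu> (rat_apply s Q z l) \<le> vnorm s z"
  unfolding rat_apply_def
  by (intro sum_le vnorm_nonneg) (auto intro: order_trans[OF rat_mult_le vnorm_ge])

text \<open>
  Rational matrices do not increase the norm, and a frame is its own inverse.
\<close>

lemma vnorm_rat_apply:
  assumes "rat_frame s Q"
  shows "vnorm s (rat_apply s Q z) = vnorm s z"
proof (rule antisym)
  show "vnorm s (rat_apply s Q z) \<le> vnorm s z"
    by (intro vnorm_le vnorm_nonneg rat_apply_le)
  have "vnorm s z = vnorm s (rat_apply s Q (rat_apply s Q z))"
    using assms by (intro vnorm_cong) (simp add: rat_apply_frame_twice)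
  also have "\<dots> \<le> vnorm s (rat_apply s Q z)"
    by (intro vnorm_le vnorm_nonneg rat_apply_le)
  finally show "vnorm s z \<le> vnorm s (rat_apply s Q z)" .
qed

text \<open>
  The ping-pong step. If the frame coordinate \<open>a\<close> of \<open>z\<close>, which is stretched most, has the full norm of
  \<open>z\<close>, then after the turn it strictly dominates the other ones. In another frame \<open>R\<close> it contributes to the
  coordinate \<open>b\<close> with the rational factor \<open>(R Q)\<^sub>b\<^sub>a\<close>; if this is not zero, that coordinate has the full
  norm as well.
\<close>

lemma turn_expands:
  fixes Q R :: "nat \<Rightarrow> nat \<Rightarrow> rat"
  assumes Q: "rat_frame s Q" and a: "a < s" "\<And>l. l < s \<Longrightarrow> l \<noteq> a \<Longrightarrow> E l < E a" and \<sigma>: "\<sigma> \<noteq> 0"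
    and z: "\<nu> (rat_apply s Q z a) = vnorm s z" "vnorm s z > 0"
    and y: "\<And>l. l < s \<Longrightarrow> y l = turn u s Q E \<sigma> z l"
  shows "vnorm s y = 2 powi E a * vnorm s z" (is ?A)
    and "(\<Sum>l<s. R b l * Q l a) \<noteq> 0 \<Longrightarrow> \<nu> (rat_apply s R y b) = vnorm s y" (is "?C \<Longrightarrow> ?B")
proof -
  define \<eta> where "\<eta> = (\<lambda>j. u powi E j * rat_apply s Q z j)"
  have \<eta>a: "\<nu> (\<eta> a) = 2 powi E a * vnorm s z" by (simp add: \<eta>_def u_powi z)
  then have \<eta>a_pos: "\<nu> (\<eta> a) > 0" using z by simp
  have \<eta>_less: "\<nu> (\<eta> l) < \<nu> (\<eta> a)" if "l < s" "l \<noteq> a" for l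
  proof -
    have "\<nu> (\<eta> l) = 2 powi E l * \<nu> (rat_apply s Q z l)" by (simp add: \<eta>_def u_powi)
    also have "\<dots> \<le> 2 powi E l * vnorm s z" by (intro mult_left_mono rat_apply_le) auto
    also have "\<dots> < 2 powi E a * vnorm s z"
      using a(2)[OF that] z by (intro mult_strict_right_mono power_int_strict_increasing) auto
    finally show ?thesis using \<eta>a by simp
  qed
  have vnorm_\<eta>: "vnorm s \<eta> = \<nu> (\<eta> a)"
  proof (rule antisym)
    show "vnorm s \<eta> \<le> \<nu> (\<eta> a)"
      using \<eta>_less by (intro vnorm_le nonneg) (metis less_le order_refl)
  qed (use a in \<open>auto intro: vnorm_ge\<close>)
  have y_eq: "y l = of_rat \<sigma> * rat_apply s Q \<eta> l" if "l < s" for l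
    using y[OF that] by (simp add: turn_def \<eta>_def)
  have "vnorm s y = vnorm s (rat_apply s Q \<eta>)"
    using y_eq \<sigma> unfolding vnorm_def
    by (intro arg_cong[where f = Max] arg_cong[where f = "insert 0"] image_cong) (auto simp: rat_mult)
  then have vy: "vnorm s y = \<nu> (\<eta> a)" using vnorm_rat_apply[OF Q, of \<eta>] vnorm_\<eta> by simp
  then show ?A by (simp add: \<eta>a)
  assume ?C
  have "rat_apply s R y b = rat_apply s R (\<lambda>l. of_rat \<sigma> * rat_apply s Q \<eta> l) b"
    using y_eq by (intro rat_apply_cong) auto
  also have "\<dots> = of_rat \<sigma> * (\<Sum>j<s. of_rat (\<Sum>i<s. R b i * Q i j) * \<eta> j)"
    using rat_apply_rat_apply[of s R Q \<eta> b] by (simp add: rat_apply_scale)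
  finally have "\<nu> (rat_apply s R y b) = \<nu> (\<Sum>j<s. of_rat (\<Sum>i<s. R b i * Q i j) * \<eta> j)"
    using \<sigma> by (simp add: rat_mult)
  also have "\<dots> = \<nu> (\<eta> a)"
    using \<open>?C\<close> a \<eta>_less \<eta>a_pos by (intro sum_dominant) auto
  finally show ?B using vy by simp
qed

end

lemma turn_inverse:
  assumes "rat_frame s Q" "u \<noteq> 0" "\<sigma> * \<sigma> = 1" "l < s"
    and y: "\<And>l. l < s \<Longrightarrow> y l = turn u s Q E \<sigma> z l"
  shows "turn u s Q (\<lambda>l. - E l) \<sigma> y l = z l"
proof -
  define \<eta> where "\<eta> = (\<lambda>j. u powi E j * rat_apply s Q z j)"
  have yQ: "rat_apply s Q y j = of_rat \<sigma> * \<eta> j" if "j < s" for j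
  proof -
    have "rat_apply s Q y j = rat_apply s Q (\<lambda>l. of_rat \<sigma> * rat_apply s Q \<eta> l) j"
      using y by (intro rat_apply_cong) (simp add: turn_def \<eta>_def)
    then show ?thesis using assms that by (simp add: rat_apply_scale rat_apply_frame_twice)
  qed
  have "turn u s Q (\<lambda>l. - E l) \<sigma> y l = of_rat \<sigma> * rat_apply s Q (\<lambda>j. of_rat \<sigma> * rat_apply s Q z j) l"
    unfolding turn_def using assms(2) yQ
    by (intro arg_cong[where f = "(*) (of_rat \<sigma>)"] rat_apply_cong)
       (simp add: \<eta>_def power_int_minus field_simps)
  also have "\<dots> = (of_rat \<sigma> * of_rat \<sigma>) * z l"
    using assms by (simp add: rat_apply_scale rat_apply_frame_twice)
  also have "of_rat \<sigma> * of_rat \<sigma> = (1 :: complex)"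
    by (metis assms(3) of_rat_1 of_rat_mult)
  finally show ?thesis by simp
qed

lemma turn_norm:
  assumes "rat_frame s Q" "cmod u = 1" "\<sigma> * \<sigma> = 1"
  shows "(\<Sum>l<s. (cmod (turn u s Q E \<sigma> z l))\<^sup>2) = (\<Sum>l<s. (cmod (z l))\<^sup>2)"
proof -
  have "\<sigma> = 1 \<or> \<sigma> = -1" using assms(3) by (metis square_eq_1_iff)
  then have "cmod (of_rat \<sigma>) = 1" by auto
  then have "(\<Sum>l<s. (cmod (turn u s Q E \<sigma> z l))\<^sup>2)
      = (\<Sum>l<s. (cmod (rat_apply s Q (\<lambda>j. u powi E j * rat_apply s Q z j) l))\<^sup>2)"
    by (simp add: turn_def norm_mult)
  then show ?thesis
    using assms by (simp add: rat_apply_norm norm_mult norm_power_int)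
qed

lemma turn_diff: "turn u s Q E \<sigma> (\<lambda>l. z l - w l) l = turn u s Q E \<sigma> z l - turn u s Q E \<sigma> w l"
  by (simp add: turn_def rat_apply_diff right_diff_distrib)

lemma turn_cong: "(\<And>l. l < s \<Longrightarrow> z l = w l) \<Longrightarrow> turn u s Q E \<sigma> z l = turn u s Q E \<sigma> w l"
  by (simp add: turn_def rat_apply_cong[of s z w])

section \<open>Householder frames\<close>

text \<open>
  The reflection in the hyperplane orthogonal to \<open>(1, t, \<dots>, t\<^bsup>s-1\<^esup>)\<close>. As \<open>t\<close> tends to \<open>0\<close> it becomes
  diagonal, so that turns in these frames approach diagonal matrices.
\<close>

definition householder :: "nat \<Rightarrow> rat \<Rightarrow> nat \<Rightarrow> nat \<Rightarrow> rat" where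
  "householder s t l j = (if l = j then 1 else 0) - 2 * t ^ (l + j) / (\<Sum>i<s. t ^ (2 * i))"

lemma even_power_sum_pos:
  fixes t :: rat
  assumes "s > 0"
  shows "(\<Sum>i<s. t ^ (2 * i)) > 0"
proof -
  have "0 < t ^ (2 * 0)" by simp
  also have "\<dots> \<le> (\<Sum>i<s. t ^ (2 * i))"
    using assms by (intro member_le_sum) auto
  finally show ?thesis .
qed

lemma householder_mult:
  fixes t r :: rat
  assumes "a < s" "b < s"
  defines "G \<equiv> \<lambda>x. \<Sum>i<s. x ^ (2 * i)"
  shows "(\<Sum>l<s. householder s t a l * householder s r l b) =
    (if a = b then 1 else 0) - 2 * r ^ (a + b) / G r - 2 * t ^ (a + b) / G t
      + 4 * t ^ a * r ^ b * (\<Sum>l<s. (t * r) ^ l) / (G t * G r)"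
proof -
  have "(\<Sum>l<s. householder s t a l * householder s r l b) =
     (\<Sum>l<s. (if a = l then (if a = b then 1 else 0) else 0)
        - (if a = l then 2 * r ^ (a + b) / G r else 0)
        - (if l = b then 2 * t ^ (a + b) / G t else 0)
        + 4 * t ^ a * r ^ b / (G t * G r) * (t * r) ^ l)"
    by (intro sum.cong refl) (auto simp: householder_def G_def power_add power_mult_distrib algebra_simps)
  also have "\<dots> = (if a = b then 1 else 0) - 2 * r ^ (a + b) / G r - 2 * t ^ (a + b) / G t
      + 4 * t ^ a * r ^ b * (\<Sum>l<s. (t * r) ^ l) / (G t * G r)"
    using assms(1,2) by (simp add: sum.distrib sum_subtractf sum_distrib_left sum_divide_distrib)
  finally show ?thesis .
qed

lemma rat_frame_householder:
  assumes "s > 0"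
  shows "rat_frame s (householder s t)"
  unfolding rat_frame_def
proof (intro conjI allI impI)
  fix l k assume lk: "l < s" "k < s"
  define G where "G = (\<Sum>i<s. t ^ (2 * i))"
  have G: "G > 0" unfolding G_def by (rule even_power_sum_pos[OF assms])
  have "(\<Sum>l<s. (t * t) ^ l) = G"
    by (simp add: G_def power_mult power2_eq_square)
  then have "(\<Sum>j<s. householder s t l j * householder s t j k) =
      (if l = k then 1 else 0) - 2 * t ^ (l + k) / G - 2 * t ^ (l + k) / G + 4 * t ^ l * t ^ k * G / (G * G)"
    using householder_mult[OF lk, of t t] unfolding G_def[symmetric] by simp
  also have "\<dots> = (if l = k then 1 else 0)" using G by (simp add: power_add)
  finally show "(\<Sum>j<s. householder s t l j * householder s t j k) = (if l = k then 1 else 0)" .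
qed (simp add: householder_def add.commute)

lemma power_gap:
  fixes r t :: rat
  assumes "0 < r" "r < t" "l \<le> q"
  shows "t ^ q * (t ^ l - r ^ l)\<^sup>2 \<le> t ^ (2 * l) * (t ^ q - r ^ q)"
proof -
  have le: "r ^ l \<le> t ^ l" using assms by (intro power_mono) auto
  have "t ^ l * r ^ q = t ^ l * r ^ l * r ^ (q - l)" using assms by (simp flip: power_add)
  also have "\<dots> \<le> t ^ l * r ^ l * t ^ (q - l)"
    using assms by (intro mult_left_mono power_mono) auto
  also have "\<dots> = t ^ q * r ^ l" using assms by (simp add: mult_ac flip: power_add)
  finally have *: "t ^ q * (t ^ l - r ^ l) \<le> t ^ l * (t ^ q - r ^ q)" by (simp add: algebra_simps)
  have "t ^ q * (t ^ l - r ^ l)\<^sup>2 = (t ^ q * (t ^ l - r ^ l)) * (t ^ l - r ^ l)"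
    by (simp add: power2_eq_square)
  also have "\<dots> \<le> (t ^ l * (t ^ q - r ^ q)) * (t ^ l - r ^ l)"
    using * le by (intro mult_right_mono) auto
  also have "\<dots> \<le> (t ^ l * (t ^ q - r ^ q)) * t ^ l"
    using assms by (intro mult_left_mono mult_nonneg_nonneg) (auto intro: power_mono)
  finally show ?thesis by (simp add: mult_ac power2_eq_square power_mult)
qed

text \<open>
  With \<open>G x = \<Sum>x\<^bsup>2i\<^esup>\<close>, \<open>q = s - 1\<close> and \<open>D = \<Sum>(t\<^sup>l - r\<^sup>l)\<^sup>2\<close>, the entry equals
  \<open>-2 (t\<^sup>q D + G t (r\<^sup>q - t\<^sup>q)) / (G t G r)\<close>. For \<open>t < r\<close> both summands are nonnegative and the second is
  positive; for \<open>r < t\<close> the second prevails, which is seen by comparing the sums \<open>D\<close> and \<open>G t\<close> term by term.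
\<close>

lemma householder_cross_nonzero:
  fixes t r :: rat
  assumes s: "s \<ge> 2" and "0 < t" "0 < r" "t \<noteq> r"
  shows "(\<Sum>l<s. householder s t (s - 1) l * householder s r l 0) \<noteq> 0"
proof -
  define q where "q = s - 1"
  define G where "G = (\<lambda>x::rat. \<Sum>i<s. x ^ (2 * i))"
  define D where "D = (\<Sum>l<s. (t ^ l - r ^ l)\<^sup>2)"
  have G: "G t > 0" "G r > 0" unfolding G_def using s by (auto intro!: even_power_sum_pos)
  have D: "D = G t + G r - 2 * (\<Sum>l<s. (t * r) ^ l)"
  proof -
    have "(t ^ l - r ^ l)\<^sup>2 = t ^ (2 * l) + r ^ (2 * l) - 2 * (t * r) ^ l" for l
      by (simp add: power2_diff power_even_eq power_mult_distrib)
    then show ?thesis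
      by (simp add: D_def G_def sum.distrib sum_subtractf sum_distrib_left)
  qed
  have X: "(\<Sum>l<s. householder s t q l * householder s r l 0) * (G t * G r)
      = - 2 * (t ^ q * D + G t * (r ^ q - t ^ q))"
  proof -
    define C where "C = (\<Sum>l<s. (t * r) ^ l)"
    have "(\<Sum>l<s. householder s t q l * householder s r l 0)
        = 0 - 2 * r ^ q / G r - 2 * t ^ q / G t + 4 * t ^ q * C / (G t * G r)"
      using s by (subst householder_mult) (auto simp: q_def G_def C_def)
    then show ?thesis
      using G unfolding D C_def[symmetric] by (simp add: field_simps)
  qed
  have "t ^ q * D + G t * (r ^ q - t ^ q) \<noteq> 0"
  proof (cases "t < r")
    case True
    have "D \<ge> 0" unfolding D_def by (intro sum_nonneg) auto
    moreover have "t ^ q < r ^ q" using True assms by (intro power_strict_mono) (auto simp: q_def)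
    ultimately have "t ^ q * D + G t * (r ^ q - t ^ q) > 0"
      using G assms by (intro add_nonneg_pos) auto
    then show ?thesis by simp
  next
    case False
    then have rt: "r < t" using assms by simp
    then have less: "r ^ q < t ^ q" using assms by (intro power_strict_mono) (auto simp: q_def)
    have "(\<Sum>l<s. t ^ q * (t ^ l - r ^ l)\<^sup>2) < (\<Sum>l<s. t ^ (2 * l) * (t ^ q - r ^ q))"
    proof (rule sum_strict_mono_ex1)
      show "\<exists>l\<in>{..<s}. t ^ q * (t ^ l - r ^ l)\<^sup>2 < t ^ (2 * l) * (t ^ q - r ^ q)"
        using s less by (intro bexI[of _ 0]) auto
      show "\<forall>l\<in>{..<s}. t ^ q * (t ^ l - r ^ l)\<^sup>2 \<le> t ^ (2 * l) * (t ^ q - r ^ q)"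
        using assms rt by (auto intro!: power_gap simp: q_def)
    qed simp
    then have "t ^ q * D < G t * (t ^ q - r ^ q)"
      by (simp add: D_def G_def sum_distrib_left sum_distrib_right)
    then show ?thesis by (simp add: algebra_simps)
  qed
  then have "(\<Sum>l<s. householder s t q l * householder s r l 0) * (G t * G r) \<noteq> 0"
    unfolding X mult_eq_0_iff by linarith
  then show ?thesis unfolding q_def mult_eq_0_iff by blast
qed

context circle_norm
begin

text \<open>
  Interpolation at rational points involves only rational factors. The induction splits off one
  point by synthetic division.
\<close>

lemma coeff_less_of_values:
  assumes "finite T" "degree P < card T" "M > 0"
    and "\<And>t. t \<in> T \<Longrightarrow> \<nu> (poly P (of_rat t)) < M"
  shows "\<nu> (coeff P i) < M"
  using assms(1,2,4)
proof (induction T arbitrary: P i rule: finite_induct)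
  case (insert c T)
  define S where "S = synthetic_div P (of_rat c)"
  have P: "P = pCons (poly P (of_rat c)) S - smult (of_rat c) S"
    using synthetic_div_correct[of P "of_rat c"] unfolding S_def by (metis add_diff_cancel_right')
  have Pc: "\<nu> (poly P (of_rat c)) < M" using insert.prems by simp
  have S: "\<nu> (coeff S i) < M" for i
  proof (cases "degree P = 0")
    case True
    then have "S = 0" by (simp add: S_def synthetic_div_eq_0_iff)
    then show ?thesis using assms by simp
  next
    case False
    show ?thesis
    proof (rule insert.IH)
      show "degree S < card T" using insert False by (simp add: S_def degree_synthetic_div)
      fix t assume t: "t \<in> T"
      then have tc: "t \<noteq> c" using insert by auto
      have "of_rat (t - c) * poly S (of_rat t) = poly P (of_rat t) - poly P (of_rat c)"
      proof -
        have "poly P (of_rat t) = poly P (of_rat c) + of_rat t * poly S (of_rat t) - of_rat c * poly S (of_rat t)"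
          using arg_cong[OF P, of "\<lambda>p. poly p (of_rat t)"] by (simp only: poly_diff poly_pCons poly_smult)
        then show ?thesis by (simp add: of_rat_diff left_diff_distrib)
      qed
      then have "\<nu> (poly S (of_rat t)) = \<nu> (poly P (of_rat t) - poly P (of_rat c))"
        using rat_mult[of "t - c" "poly S (of_rat t)"] tc by simp
      also have "\<dots> < M"
        using diff_le[of "poly P (of_rat t)" "poly P (of_rat c)"] insert.prems(2)[of t] t Pc by simp
      finally show "\<nu> (poly S (of_rat t)) < M" .
    qed
  qed
  have "coeff P i = coeff (pCons (poly P (of_rat c)) S) i - of_rat c * coeff S i"
    by (subst P) simp
  moreover have "\<nu> (coeff (pCons (poly P (of_rat c)) S) i) < M"
    using Pc S by (auto simp: coeff_pCons split: nat.split)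
  moreover have "\<nu> (of_rat c * coeff S i) < M"
    using le_less_trans[OF rat_mult_le S] .
  ultimately show ?case
    using diff_le[of "coeff (pCons (poly P (of_rat c)) S) i" "of_rat c * coeff S i"] by simp
qed simp

text \<open>
  Up to the factor \<open>\<Sum>t\<^bsup>2i\<^esup>\<close>, the last frame coordinate of \<open>y\<close> is a polynomial in \<open>t\<close> of degree at most
  \<open>2s - 2\<close> whose coefficients determine \<open>y\<close> over the rationals. If it were small for more than \<open>2s - 2\<close>
  values of \<open>t\<close>, then its coefficients, and with them \<open>y\<close>, would have a norm smaller than that of \<open>y\<close>.
\<close>

lemma few_contracting_frames:
  assumes s: "s \<ge> 2" and y: "vnorm s y > 0" and T: "finite T"
    and small: "\<And>t. t \<in> T \<Longrightarrow> \<nu> (rat_apply s (householder s t) y (s - 1)) < vnorm s y"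
  shows "card T \<le> 2 * s - 2"
proof (rule ccontr)
  assume "\<not> card T \<le> 2 * s - 2"
  define q where "q = s - 1"
  have q: "q > 0" "q < s" using s by (auto simp: q_def)
  define P where "P = (\<Sum>l<s. monom (y q) (2 * l)) - (\<Sum>j<s. monom (2 * y j) (q + j))"
  have "degree P \<le> 2 * s - 2"
    unfolding P_def
    by (intro degree_diff_le degree_sum_le) (auto intro!: order_trans[OF degree_monom_le] simp: q_def)
  then have deg: "degree P < card T" using \<open>\<not> card T \<le> 2 * s - 2\<close> by simp
  have "\<nu> (poly P (of_rat t)) < vnorm s y" if "t \<in> T" for t
  proof -
    define G where "G = (\<Sum>i<s. t ^ (2 * i))"
    have G: "G > 0" unfolding G_def by (rule even_power_sum_pos) (use s in auto)
    have "of_rat G * rat_apply s (householder s t) y q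
        = (\<Sum>j<s. of_rat (G * householder s t q j) * y j)"
      by (simp add: rat_apply_def sum_distrib_left of_rat_mult mult_ac)
    also have "\<dots> = (\<Sum>j<s. (if q = j then of_rat G * y q else 0) - of_rat t ^ (q + j) * (2 * y j))"
      using G unfolding householder_def G_def[symmetric]
      by (intro sum.cong refl) (auto simp: of_rat_diff of_rat_mult of_rat_power algebra_simps)
    also have "\<dots> = of_rat G * y q - (\<Sum>j<s. of_rat t ^ (q + j) * (2 * y j))"
      using q by (simp add: sum_subtractf)
    also have "\<dots> = (\<Sum>l<s. y q * of_rat t ^ (2 * l)) - (\<Sum>j<s. 2 * y j * of_rat t ^ (q + j))"
      by (simp add: G_def of_rat_sum of_rat_power sum_distrib_left mult.commute)
    also have "\<dots> = poly P (of_rat t)"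
      by (simp add: P_def poly_sum poly_monom)
    finally have "\<nu> (poly P (of_rat t)) = \<nu> (rat_apply s (householder s t) y q)"
      using G rat_mult[of G "rat_apply s (householder s t) y q"] by simp
    then show ?thesis using small[OF that] by (simp add: q_def)
  qed
  then have coeff: "\<nu> (coeff P i) < vnorm s y" for i
    using coeff_less_of_values[OF T deg y] by blast
  have cP: "coeff P i = (\<Sum>l<s. if 2 * l = i then y q else 0) - (\<Sum>j<s. if q + j = i then 2 * y j else 0)" for i
    by (simp add: P_def coeff_sum)
  \<comment> \<open>The constant coefficient is the last coordinate, and the coefficient of degree q + j then gives the coordinate j.\<close>
  have yq: "\<nu> (y q) < vnorm s y"
  proof -
    have "(\<Sum>l<s. if 2 * l = 0 then y q else 0) = (\<Sum>l<s. if l = 0 then y q else 0)"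
      by (intro sum.cong) auto
    then have "coeff P 0 = y q" using q cP[of 0] by simp
    then show ?thesis using coeff[of 0] by simp
  qed
  have "\<nu> (y j) < vnorm s y" if j: "j < s" for j
  proof -
    define w where "w = (\<Sum>l<s. if 2 * l = q + j then y q else 0)"
    have w: "\<nu> w < vnorm s y"
      unfolding w_def using yq y by (intro sum_less) auto
    have "(\<Sum>i<s. if q + i = q + j then 2 * y i else 0) = 2 * y j"
      using j by simp
    then have "coeff P (q + j) = w - 2 * y j" by (simp only: cP w_def)
    then have "2 * y j = w - coeff P (q + j)" by simp
    then have "\<nu> (2 * y j) < vnorm s y"
      using diff_le[of w "coeff P (q + j)"] w coeff[of "q + j"] by simp
    then show ?thesis using rat_mult[of 2 "y j"] by simp
  qed
  then show False using vnorm_attained[OF y] by force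
qed

end

section \<open>Covering a ball exactly once\<close>

text \<open>
  The isometries \<open>f 0, \<dots>, f (k - 1)\<close> are turns about the origin, \<open>f k\<close> is a turn about \<open>p\<close>, each in its own
  frame \<open>Q i\<close> and with exponents \<open>E i\<close> that have a strict maximum at the first and a strict minimum at the
  last coordinate; \<open>Z\<close> are complex coordinates, and \<open>B\<close> is to be covered. By \<open>cross\<close>, a point in the most
  stretched direction of one map is in general position for all others. The normalisation of \<open>p\<close> makes
  \<open>1\<close> the only height of \<open>x\<close> at which the leading term of \<open>x - p\<close> need not be that of \<open>x\<close> or of \<open>- p\<close>; as the
  least exponents are distinct, at most one of the inverse rotations that expand a given \<open>y\<close> takes it to
  that height. The bounds in \<open>few\<close> and \<open>cover\<close> leave \<open>2s + 2 - (2s - 2) - 1 = 3\<close> good preimages.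
\<close>

locale ball_motions = circle_norm u \<nu> for u \<nu> +
  fixes s k :: nat and Q :: "nat \<Rightarrow> nat \<Rightarrow> nat \<Rightarrow> rat" and E :: "nat \<Rightarrow> nat \<Rightarrow> int"
    and \<sigma> :: "nat \<Rightarrow> rat" and Z :: "'a::zero \<Rightarrow> nat \<Rightarrow> complex"
    and f :: "nat \<Rightarrow> 'a \<Rightarrow> 'a" and p c :: 'a and B :: "'a set"
  assumes s: "s \<ge> 2"
    and Z_inj: "(\<And>l. l < s \<Longrightarrow> Z x l = Z y l) \<Longrightarrow> x = y"
    and Z_zero: "l < s \<Longrightarrow> Z 0 l = 0"
    and frame: "i \<le> k \<Longrightarrow> rat_frame s (Q i)"
    and cross: "\<lbrakk>i \<le> k; j \<le> k; i \<noteq> j\<rbrakk> \<Longrightarrow> (\<Sum>l<s. Q i (s - 1) l * Q j l 0) \<noteq> 0"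
    and E_max: "\<lbrakk>i \<le> k; l < s; l \<noteq> 0\<rbrakk> \<Longrightarrow> E i l < E i 0"
    and E_min: "\<lbrakk>i \<le> k; l < s; l \<noteq> s - 1\<rbrakk> \<Longrightarrow> E i (s - 1) < E i l"
    and E_pos: "i \<le> k \<Longrightarrow> E i 0 > 0"
    and E_neg: "i \<le> k \<Longrightarrow> E i (s - 1) < 0"
    and E_inj: "inj_on (\<lambda>i. E i (s - 1)) {..<k}"
    and \<sigma>: "i \<le> k \<Longrightarrow> \<sigma> i * \<sigma> i = 1"
    and few: "y \<noteq> 0 \<Longrightarrow> card {i. i < k \<and> \<nu> (rat_apply s (Q i) (Z y) (s - 1)) < vnorm s (Z y)} \<le> 2 * s - 2"
    and f_rotation: "\<lbrakk>i < k; l < s\<rbrakk> \<Longrightarrow> Z (f i x) l = turn u s (Q i) (E i) (\<sigma> i) (Z x) l"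
    and f_affine: "l < s \<Longrightarrow>
      Z (f k x) l = Z p l + turn u s (Q k) (E k) (\<sigma> k) (\<lambda>l. Z x l - Z p l) l"
    and f_inj: "i \<le> k \<Longrightarrow> inj (f i)"
    and f_zero: "i < k \<Longrightarrow> f i 0 = 0"
    and p: "vnorm s (Z p) = 1" "\<nu> (rat_apply s (Q k) (Z p) 0) = 1" "\<nu> (rat_apply s (Q k) (Z p) (s - 1)) = 1"
    and c: "f k c = 0" "c \<in> B" and zero_in: "0 \<in> B"
    and cover: "\<lbrakk>y \<in> B; y \<noteq> 0\<rbrakk> \<Longrightarrow> 2 * s + 2 \<le> card {i. i < k \<and> (\<exists>x\<in>B. f k x \<in> B \<and> f i x = y)}"
begin

definition height :: "'a \<Rightarrow> real" where "height x = vnorm s (Z x)"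

text \<open>
  The coordinate that \<open>f i\<close> stretches most is too small for \<open>f i\<close> to be sure of raising the height.
\<close>

definition contracted :: "nat \<Rightarrow> 'a \<Rightarrow> bool" where
  "contracted i x \<longleftrightarrow> \<nu> (rat_apply s (Q i) (Z x) 0) < height x"

text \<open>
  The same for the inverse of \<open>f i\<close>, which stretches the last coordinate most.
\<close>

definition back_contracted :: "nat \<Rightarrow> 'a \<Rightarrow> bool" where
  "back_contracted i y \<longleftrightarrow> \<nu> (rat_apply s (Q i) (Z y) (s - 1)) < height y"

text \<open>
  Seen from \<open>p\<close>, the map \<open>f k\<close> expands \<open>x\<close>; the lower bound makes the translation by \<open>p\<close> negligible afterwards.
\<close>

definition affine_expanded :: "'a \<Rightarrow> bool" where
  "affine_expanded x \<longleftrightarrow>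
     \<nu> (rat_apply s (Q k) (\<lambda>l. Z x l - Z p l) 0) = vnorm s (\<lambda>l. Z x l - Z p l) \<and>
     1 \<le> vnorm s (\<lambda>l. Z x l - Z p l)"

text \<open>
  The points that may be used for \<open>A\<close>. An edge can descend only if the map along it contracts; the last
  two conditions leave at most one such edge at \<open>x\<close>, and at \<open>f i x\<close> if the edge to \<open>x\<close> is of this kind. The point \<open>c\<close> is admitted,
  although \<open>f k\<close> contracts it, because the origin has no other nonzero preimage.
\<close>

definition admissible :: "'a set" where
  "admissible = {x \<in> B. f k x \<in> B \<and> x \<noteq> 0 \<and> (affine_expanded x \<or> x = c)
     \<and> (\<forall>i<k. \<forall>j<k. contracted i x \<longrightarrow> contracted j x \<longrightarrow> i = j)
     \<and> (\<forall>i<k. \<forall>j<k. back_contracted i (f i x) \<longrightarrow> back_contracted j (f i x) \<longrightarrow> i = j)}"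

lemma height_zero [simp]: "height 0 = 0"
  unfolding height_def vnorm_eq_0 using Z_zero by simp

lemma height_pos: "x \<noteq> 0 \<Longrightarrow> height x > 0"
  using Z_inj[of x 0] Z_zero vnorm_eq_0[of s "Z x"] vnorm_nonneg[of s "Z x"]
  unfolding height_def by (metis less_eq_real_def)

lemma two_powi_gt: "n > 0 \<Longrightarrow> (2::real) powi n > 1"
  using power_int_strict_increasing[of 0 n "2::real"] by simp

lemma \<sigma>_nz: "i \<le> k \<Longrightarrow> \<sigma> i \<noteq> 0"
  using \<sigma>[of i] by auto

lemma cross_sym:
  assumes "i \<le> k" "j \<le> k" "i \<noteq> j"
  shows "(\<Sum>l<s. Q j 0 l * Q i l (s - 1)) \<noteq> 0"
proof -
  have "(\<Sum>l<s. Q j 0 l * Q i l (s - 1)) = (\<Sum>l<s. Q i (s - 1) l * Q j l 0)"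
    using frame[OF assms(1)] frame[OF assms(2)] s
    by (intro sum.cong) (auto simp: rat_frame_def mult.commute)
  then show ?thesis using cross[OF assms] by simp
qed

text \<open>
  By \<open>cross\<close>, the image points in a direction that is expanded by the inverses of all other maps.
\<close>

lemma rotation_up:
  assumes "i < k" "x \<noteq> 0" "\<not> contracted i x"
  shows "height x < height (f i x)"
    and "\<lbrakk>j \<le> k; j \<noteq> i\<rbrakk> \<Longrightarrow> \<nu> (rat_apply s (Q j) (Z (f i x)) (s - 1)) = height (f i x)"
proof -
  have eq: "\<nu> (rat_apply s (Q i) (Z x) 0) = vnorm s (Z x)"
    using assms(3) rat_apply_le[of s "Q i" "Z x" 0] by (simp add: contracted_def height_def)
  have pos: "vnorm s (Z x) > 0" using height_pos[OF assms(2)] by (simp add: height_def)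
  have i: "i \<le> k" using assms by simp
  have s0: "0 < s" using s by simp
  note exp = turn_expands[OF frame[OF i] s0 E_max[OF i] \<sigma>_nz[OF i] eq pos f_rotation[OF assms(1)]]
  show "height x < height (f i x)"
    using exp(1) pos two_powi_gt[OF E_pos[OF i]] by (simp add: height_def)
  show "\<nu> (rat_apply s (Q j) (Z (f i x)) (s - 1)) = height (f i x)" if "j \<le> k" "j \<noteq> i"
    unfolding height_def using exp(2) cross that i by blast
qed

lemma rotation_back_up:
  assumes "i < k" "f i x \<noteq> 0" "\<not> back_contracted i (f i x)"
  shows "height x = 2 powi (- E i (s - 1)) * height (f i x)"
    and "\<lbrakk>j \<le> k; j \<noteq> i\<rbrakk> \<Longrightarrow> \<nu> (rat_apply s (Q j) (Z x) 0) = height x"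
proof -
  have eq: "\<nu> (rat_apply s (Q i) (Z (f i x)) (s - 1)) = vnorm s (Z (f i x))"
    using assms(3) rat_apply_le[of s "Q i" "Z (f i x)" "s - 1"] by (simp add: back_contracted_def height_def)
  have pos: "vnorm s (Z (f i x)) > 0" using height_pos[OF assms(2)] by (simp add: height_def)
  have i: "i \<le> k" using assms by simp
  have s1: "s - 1 < s" using s by simp
  have E: "- E i l < - E i (s - 1)" if "l < s" "l \<noteq> s - 1" for l using E_min[OF i that] by simp
  have x: "Z x l = turn u s (Q i) (\<lambda>l. - E i l) (\<sigma> i) (Z (f i x)) l" if "l < s" for l
    using turn_inverse[OF frame[OF i] u_nz \<sigma>[OF i] that f_rotation[OF assms(1)]] by simp
  note exp = turn_expands[OF frame[OF i] s1 E \<sigma>_nz[OF i] eq pos x]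
  show "height x = 2 powi (- E i (s - 1)) * height (f i x)"
    using exp(1) by (simp add: height_def)
  show "\<nu> (rat_apply s (Q j) (Z x) 0) = height x" if "j \<le> k" "j \<noteq> i"
    unfolding height_def using exp(2) cross_sym that i by blast
qed

lemma rotation_back_up_less:
  assumes "i < k" "f i x \<noteq> 0" "\<not> back_contracted i (f i x)"
  shows "height (f i x) < height x"
  using rotation_back_up(1)[OF assms] height_pos[OF assms(2)] two_powi_gt[of "- E i (s - 1)"] E_neg[of i] assms(1)
  by simp

text \<open>
  After the turn about \<open>p\<close> the difference from \<open>p\<close> has norm greater than \<open>1\<close>, the norm of \<open>p\<close>, so that \<open>f k x\<close>
  inherits its leading term.
\<close>

lemma affine_up:
  assumes "affine_expanded x"
  shows "height x < height (f k x)" and "j < k \<Longrightarrow> \<not> back_contracted j (f k x)"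
proof -
  define w where "w = (\<lambda>l. Z (f k x) l - Z p l)"
  define d where "d = vnorm s (\<lambda>l. Z x l - Z p l)"
  have d: "d \<ge> 1" "\<nu> (rat_apply s (Q k) (\<lambda>l. Z x l - Z p l) 0) = d"
    using assms by (auto simp: affine_expanded_def d_def)
  have s0: "0 < s" using s by simp
  have w: "w l = turn u s (Q k) (E k) (\<sigma> k) (\<lambda>l. Z x l - Z p l) l" if "l < s" for l
    using f_affine[OF that] by (simp add: w_def)
  have pre: "\<nu> (rat_apply s (Q k) (\<lambda>l. Z x l - Z p l) 0) = vnorm s (\<lambda>l. Z x l - Z p l)"
      "vnorm s (\<lambda>l. Z x l - Z p l) > 0"
    using d by (auto simp: d_def)
  note exp = turn_expands[OF frame[OF order_refl] s0 E_max[OF order_refl] \<sigma>_nz[OF order_refl] pre w,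
      folded d_def]
  have vw: "vnorm s w = 2 powi (E k 0) * d" using exp(1) d by simp
  then have dw: "d < vnorm s w" using d two_powi_gt[OF E_pos[of k]] by simp
  have fk: "Z (f k x) = (\<lambda>l. w l + Z p l)" by (simp add: w_def)
  have h: "height (f k x) = vnorm s w"
    unfolding height_def fk using dw d p by (intro vnorm_add_dominant) simp
  have "height x \<le> max d 1"
    using vnorm_add_le[of s "\<lambda>l. Z x l - Z p l" "Z p"] p by (simp add: height_def d_def)
  then show "height x < height (f k x)" using h dw d by simp
  show "\<not> back_contracted j (f k x)" if j: "j < k"
  proof -
    have *: "\<nu> (rat_apply s (Q j) w (s - 1)) = vnorm s w"
      using exp(2) cross[of j k] j d by auto
    have "\<nu> (rat_apply s (Q j) (Z (f k x)) (s - 1)) = vnorm s w"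
      unfolding fk rat_apply_add using * dw d p rat_apply_le[of s "Q j" "Z p" "s - 1"]
      by (subst add_dominant) auto
    then show ?thesis by (simp add: back_contracted_def h)
  qed
qed

text \<open>
  The inverse of \<open>f k\<close> expands \<open>- p = 0 - p\<close>, hence \<open>c\<close> lies high in the direction of the last frame vector of \<open>f k\<close>.
\<close>

lemma c_expanded:
  shows "height c > 1" and "j < k \<Longrightarrow> \<not> contracted j c"
proof -
  define w where "w = (\<lambda>l. Z c l - Z p l)"
  have s1: "s - 1 < s" using s by simp
  have E: "- E k l < - E k (s - 1)" if "l < s" "l \<noteq> s - 1" for l using E_min[OF order_refl that] by simp
  have "- Z p l = turn u s (Q k) (E k) (\<sigma> k) w l" if "l < s" for l
    using f_affine[OF that, of c] Z_zero[OF that] c(1) by (simp add: w_def minus_unique)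
  then have w: "w l = turn u s (Q k) (\<lambda>l. - E k l) (\<sigma> k) (\<lambda>l. - Z p l) l" if "l < s" for l
    using turn_inverse[OF frame[OF order_refl] u_nz \<sigma>[OF order_refl] that, of "\<lambda>l. - Z p l"] by simp
  have "rat_apply s (Q k) (\<lambda>l. - Z p l) (s - 1) = - rat_apply s (Q k) (Z p) (s - 1)"
    using rat_apply_scale[of s "Q k" "-1" "Z p"] by simp
  then have pp: "\<nu> (rat_apply s (Q k) (\<lambda>l. - Z p l) (s - 1)) = vnorm s (\<lambda>l. - Z p l)" "vnorm s (\<lambda>l. - Z p l) > 0"
    using p by (auto simp: vnorm_minus)
  note exp = turn_expands[OF frame[OF order_refl] s1 E \<sigma>_nz[OF order_refl] pp w]
  have vw: "vnorm s w > 1" using exp(1) two_powi_gt[of "- E k (s - 1)"] E_neg[of k] p by (simp add: vnorm_minus)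
  have Zc: "Z c = (\<lambda>l. w l + Z p l)" by (simp add: w_def)
  have h: "height c = vnorm s w"
    unfolding height_def Zc using vw p by (intro vnorm_add_dominant) simp
  then show "height c > 1" using vw by simp
  show "\<not> contracted j c" if j: "j < k"
  proof -
    have *: "\<nu> (rat_apply s (Q j) w 0) = vnorm s w"
      using exp(2) cross_sym[of k j] j by auto
    have "\<nu> (rat_apply s (Q j) (Z c) 0) = vnorm s w"
      unfolding Zc rat_apply_add using * vw p rat_apply_le[of s "Q j" "Z p" 0]
      by (subst add_dominant) auto
    then show ?thesis by (simp add: contracted_def h)
  qed
qed

lemma c_admissible: "c \<in> admissible"
proof -
  have nz: "c \<noteq> 0" using c_expanded(1) by auto
  have "i = j" if "i < k" "j < k" "back_contracted j (f i c)" for i j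
    using rotation_up(2)[OF that(1) nz c_expanded(2)[OF that(1)], of j] that
    by (auto simp: back_contracted_def)
  then show ?thesis using c zero_in nz c_expanded(2) by (auto simp: admissible_def)
qed

lemma admissible_down:
  assumes "x \<in> admissible" "i \<le> k" "height (f i x) < height x"
  shows "(i < k \<and> contracted i x) \<or> (i = k \<and> x = c)"
proof (cases "i < k")
  case True
  then show ?thesis using rotation_up(1)[of i x] assms by (force simp: admissible_def)
next
  case False
  then show ?thesis using affine_up(1)[of x] assms by (force simp: admissible_def)
qed

lemma admissible_back_down:
  assumes "x \<in> admissible" "i \<le> k" "height x \<le> height (f i x)"
  shows "(i < k \<and> back_contracted i (f i x)) \<or> (i = k \<and> affine_expanded x)"
proof (cases "i < k")
  case True
  have "f i x \<noteq> 0"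
    using assms(1) injD[OF f_inj[OF assms(2)], of x 0] f_zero[OF True] by (auto simp: admissible_def)
  then show ?thesis using rotation_back_up_less[of i x] True assms by force
next
  case False
  have "x \<noteq> c" using assms False c c_expanded(1) by auto
  then show ?thesis using False assms by (auto simp: admissible_def)
qed

text \<open>
  If the heights of \<open>x\<close> and \<open>p\<close> differ, the higher of them dictates the leading term of \<open>x - p\<close>.
\<close>

lemma affine_expanded_of_height:
  assumes "height x \<noteq> 1" "\<nu> (rat_apply s (Q k) (Z x) 0) = height x"
  shows "affine_expanded x"
proof (cases "height x > 1")
  case True
  have diff: "(\<lambda>l. Z x l - Z p l) = (\<lambda>l. Z x l + - Z p l)" by simp
  have "vnorm s (\<lambda>l. Z x l - Z p l) = height x"
    unfolding diff height_def using True p by (intro vnorm_add_dominant) (simp add: vnorm_minus height_def)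
  moreover have "\<nu> (rat_apply s (Q k) (\<lambda>l. Z x l - Z p l) 0) = height x"
    unfolding rat_apply_diff using True assms p add_dominant[of "- rat_apply s (Q k) (Z p) 0" "rat_apply s (Q k) (Z x) 0"] by simp
  ultimately show ?thesis using True by (simp add: affine_expanded_def)
next
  case False
  then have less: "height x < 1" using assms by simp
  have diff: "(\<lambda>l. Z x l - Z p l) = (\<lambda>l. - Z p l + Z x l)" by simp
  have "vnorm s (\<lambda>l. Z x l - Z p l) = 1"
    unfolding diff using less p by (subst vnorm_add_dominant) (simp_all add: vnorm_minus height_def)
  moreover have "\<nu> (rat_apply s (Q k) (\<lambda>l. Z x l - Z p l) 0) = 1"
    unfolding rat_apply_diff using less assms p add_dominant[of "rat_apply s (Q k) (Z x) 0" "- rat_apply s (Q k) (Z p) 0"] by simp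
  ultimately show ?thesis by (simp add: affine_expanded_def)
qed

text \<open>
  The inverse of \<open>f i\<close> turns \<open>x\<close> into a direction that all other maps expand, so that \<open>f i\<close> is the only
  descending edge at \<open>x\<close>, and \<open>x\<close> is the only lower neighbour of its other images.
\<close>

lemma admissible_up:
  assumes i: "i < k" and x: "x \<in> B" "f k x \<in> B" and nz: "f i x \<noteq> 0"
    and up: "\<not> back_contracted i (f i x)" and h: "height x \<noteq> 1"
  shows "x \<in> admissible"
proof -
  have x0: "x \<noteq> 0" using nz f_zero[OF i] by auto
  have only_i: "\<nu> (rat_apply s (Q j) (Z x) 0) = height x" if "j \<le> k" "j \<noteq> i" for j
    using rotation_back_up(2)[OF i nz up that] .
  have "affine_expanded x" using affine_expanded_of_height[OF h] only_i i by auto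
  moreover have "j = i" if "j < k" "contracted j x" for j
    using only_i[of j] that by (force simp: contracted_def)
  moreover have "l = j" if "l < k" "j < k" "back_contracted l (f l x)" "back_contracted j (f l x)" for l j
  proof (rule ccontr)
    assume "l \<noteq> j"
    have "l \<noteq> i" using that up by auto
    then have "\<not> contracted l x" using only_i[of l] that by (force simp: contracted_def)
    then show False using rotation_up(2)[OF that(1) x0, of j] that \<open>l \<noteq> j\<close> by (auto simp: back_contracted_def)
  qed
  ultimately show ?thesis using x x0 unfolding admissible_def by blast
qed

lemma admissible_down_unique:
  assumes "x \<in> admissible" "i \<le> k" "j \<le> k" "height (f i x) < height x" "height (f j x) < height x"
  shows "i = j"
  using admissible_down[OF assms(1,2,4)] admissible_down[OF assms(1,3,5)] c_expanded(2) assms(1)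
  unfolding admissible_def by blast

text \<open>
  A point reached from an admissible \<open>x\<close> by \<open>f k\<close> is contracted by no inverse rotation, so \<open>f k\<close> and a rotation
  cannot both lead up to it.
\<close>

lemma admissible_back_down_unique:
  assumes "x \<in> admissible" "x' \<in> admissible" "i \<le> k" "j \<le> k" "f i x = f j x'"
    "height x \<le> height (f i x)" "height x' \<le> height (f i x)"
  shows "i = j"
  using admissible_back_down[OF assms(1,3,6)] admissible_back_down[of x' j] affine_up(2) assms
  unfolding admissible_def by (smt (verit) mem_Collect_eq)

text \<open>
  Among the at least \<open>2s + 2\<close> indices provided by \<open>cover\<close>, discard those whose inverse does not expand \<open>y\<close> and
  the one, if any, that leads to height \<open>1\<close>; every other index leads up to an admissible point.
\<close>

lemma two_admissible_up:
  assumes y: "y \<in> B" "y \<noteq> 0"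
  shows "\<exists>x\<in>admissible. \<exists>x'\<in>admissible. x \<noteq> x' \<and> (\<exists>i\<in>{..k}. f i x = y) \<and> (\<exists>i\<in>{..k}. f i x' = y)
     \<and> height y < height x \<and> height y < height x'"
proof -
  define C where "C = {i. i < k \<and> (\<exists>x\<in>B. f k x \<in> B \<and> f i x = y)}"
  define S where "S = {i. i < k \<and> back_contracted i y}"
  define T where "T = {i. i < k \<and> 2 powi (- E i (s - 1)) * height y = 1}"
  have "card S \<le> 2 * s - 2" using few[OF y(2)] by (simp add: S_def back_contracted_def height_def)
  moreover have "card T \<le> 1"
  proof -
    have "i = j" if "i \<in> T" "j \<in> T" for i j
    proof -
      have "(2::real) powi (- E i (s - 1)) * height y = 2 powi (- E j (s - 1)) * height y"
        using that by (simp add: T_def)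
      then have "(2::real) powi (- E i (s - 1)) = 2 powi (- E j (s - 1))"
        using height_pos[OF y(2)] by simp
      then have "- E i (s - 1) = - E j (s - 1)"
        using power_int_strict_increasing[of _ _ "2::real"] by (metis less_irrefl linorder_neqE one_less_numeral_iff semiring_norm(76))
      then show "i = j" using E_inj that by (auto simp: T_def inj_on_def)
    qed
    moreover have "finite T" by (simp add: T_def)
    ultimately show ?thesis unfolding One_nat_def by (subst card_le_Suc0_iff_eq) blast+
  qed
  moreover have "2 * s + 2 \<le> card C" using cover[OF y] by (simp add: C_def)
  moreover have "finite S" "finite T" by (auto simp: S_def T_def)
  ultimately have "card (C - S - T) \<ge> 2"
    using diff_card_le_card_Diff[of S C] diff_card_le_card_Diff[of T "C - S"] s by linarith
  then obtain i j where ij: "i \<in> C - S - T" "j \<in> C - S - T" "i \<noteq> j"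
    by (metis card_le_Suc0_iff_eq card.infinite le_SucI not_less_eq_eq numeral_2_eq_2 zero_le)
  have up: "\<exists>x\<in>admissible. f l x = y \<and> height y < height x \<and> l < k" if l: "l \<in> C - S - T" for l
  proof -
    obtain x where x: "x \<in> B" "f k x \<in> B" "f l x = y" and lk: "l < k" using l by (auto simp: C_def)
    have nb: "\<not> back_contracted l (f l x)" using l lk x by (auto simp: S_def)
    have "height x = 2 powi (- E l (s - 1)) * height y"
      using rotation_back_up(1)[OF lk _ nb] x y by simp
    then have "height x \<noteq> 1" using l lk by (auto simp: T_def)
    then have "x \<in> admissible" using admissible_up[OF lk x(1,2) _ nb] x y by simp
    moreover have "height y < height x" using rotation_back_up_less[OF lk _ nb] x y by simp
    ultimately show ?thesis using x lk by blast
  qed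
  obtain x x' where "x \<in> admissible" "f i x = y" "height y < height x" "i < k"
     "x' \<in> admissible" "f j x' = y" "height y < height x'" "j < k"
    using up[OF ij(1)] up[OF ij(2)] by blast
  moreover from this have "x \<noteq> x'"
    using admissible_down_unique[of x i j] ij(3) by auto
  ultimately show ?thesis by (metis atMost_iff less_imp_le)
qed

text \<open>
  The origin is covered by \<open>c\<close> alone, from above; every other point has two admissible preimages above it.
\<close>

theorem exact_cover:
  "\<exists>A\<subseteq>B. (\<forall>x\<in>A. f k x \<in> B) \<and> (\<forall>y\<in>B. \<exists>!(i, x). i \<in> {..k} \<and> x \<in> A \<and> f i x = y)"
proof -
  have "\<exists>A\<subseteq>admissible. \<forall>y\<in>B. \<exists>!(i, x). i \<in> {..k} \<and> x \<in> A \<and> f i x = y"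
  proof (rule exact_cover_of_ranked_graph[where \<rho> = height])
    fix y assume y: "y \<in> B"
    show "\<exists>x\<in>admissible. \<exists>i\<in>{..k}. f i x = y \<and> height y < height x"
    proof (cases "y = 0")
      case True
      then show ?thesis using c_admissible c_expanded(1) c(1) by (intro bexI[of _ c] bexI[of _ k]) auto
    qed (use two_admissible_up[OF y] in blast)
  next
    fix y x i assume "y \<in> B" "x \<in> admissible" "i \<in> {..k}" "f i x = y" "height x \<le> height y"
    then show "\<exists>x\<in>admissible. \<exists>x'\<in>admissible. x \<noteq> x' \<and> (\<exists>i\<in>{..k}. f i x = y) \<and> (\<exists>i\<in>{..k}. f i x' = y)
     \<and> height y < height x \<and> height y < height x'"
      using two_admissible_up[of y] height_pos[of x] by (cases "y = 0") (auto simp: admissible_def)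
  next
    fix x x' i j
    assume "x \<in> admissible" "x' \<in> admissible" "i \<in> {..k}" "j \<in> {..k}" "f i x = f j x'"
      "height x \<le> height (f i x)" "height x' \<le> height (f i x)"
    then show "i = j" using admissible_back_down_unique[of x x' i j] by simp
  qed (auto intro: f_inj admissible_down_unique)
  then show ?thesis unfolding admissible_def by blast
qed

end

section \<open>Complex coordinates and general position\<close>

text \<open>
  For each \<open>T\<close> with \<open>q + 1\<close> elements the sum of the \<open>\<bar>y \<bullet> v j\<bar>\<close> over \<open>T\<close> is positive on the unit sphere, hence bounded
  away from \<open>0\<close> by compactness.
\<close>

lemma spread_of_few_orthogonal:
  fixes v :: "nat \<Rightarrow> 'a::euclidean_space"
  assumes J: "finite J" and few: "\<And>y. y \<noteq> 0 \<Longrightarrow> card {j\<in>J. y \<bullet> v j = 0} \<le> q"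
  shows "\<exists>\<delta>>0. \<forall>y. norm y = 1 \<longrightarrow> card {j\<in>J. \<bar>y \<bullet> v j\<bar> < \<delta>} \<le> q"
proof -
  have "\<exists>d>0. \<forall>y. norm y = 1 \<longrightarrow> d \<le> (\<Sum>j\<in>T. \<bar>y \<bullet> v j\<bar>)"
    if T: "T \<subseteq> J" "card T = Suc q" for T
  proof -
    have fT: "finite T" using T J finite_subset by blast
    have pos: "(\<Sum>j\<in>T. \<bar>y \<bullet> v j\<bar>) > 0" if "norm y = 1" for y
    proof (rule ccontr)
      assume "\<not> ?thesis"
      moreover have "(\<Sum>j\<in>T. \<bar>y \<bullet> v j\<bar>) \<ge> 0" by (intro sum_nonneg) auto
      ultimately have "(\<Sum>j\<in>T. \<bar>y \<bullet> v j\<bar>) = 0" by linarith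
      then have "\<forall>j\<in>T. y \<bullet> v j = 0" using fT by (subst (asm) sum_nonneg_eq_0_iff) auto
      then have "card T \<le> card {j\<in>J. y \<bullet> v j = 0}" using T J by (intro card_mono) auto
      then show False using few[of y] that T by force
    qed
    have "\<exists>x\<in>sphere 0 1. \<forall>y\<in>sphere (0::'a) 1. (\<Sum>j\<in>T. \<bar>x \<bullet> v j\<bar>) \<le> (\<Sum>j\<in>T. \<bar>y \<bullet> v j\<bar>)"
      by (intro continuous_attains_inf) (auto intro!: continuous_intros)
    then show ?thesis using pos by (metis mem_sphere_0)
  qed
  then obtain d where d: "\<And>T. T \<subseteq> J \<Longrightarrow> card T = Suc q \<Longrightarrow> d T > 0"
    "\<And>T y. T \<subseteq> J \<Longrightarrow> card T = Suc q \<Longrightarrow> norm y = 1 \<Longrightarrow> d T \<le> (\<Sum>j\<in>T. \<bar>y \<bullet> v j\<bar>)"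
    by metis
  define F where "F = {T. T \<subseteq> J \<and> card T = Suc q}"
  have "finite F" unfolding F_def using J by simp
  define \<delta> where "\<delta> = Min (insert 1 (d ` F)) / Suc q"
  have "\<delta> > 0" unfolding \<delta>_def using \<open>finite F\<close> d(1)
    by (intro divide_pos_pos) (auto simp: F_def)
  moreover have "card {j\<in>J. \<bar>y \<bullet> v j\<bar> < \<delta>} \<le> q" if y: "norm y = 1" for y
  proof (rule ccontr)
    assume "\<not> ?thesis"
    then obtain T where T: "T \<subseteq> {j\<in>J. \<bar>y \<bullet> v j\<bar> < \<delta>}" "card T = Suc q"
      by (meson not_less_eq_eq obtain_subset_with_card_n)
    then have TJ: "T \<subseteq> J" by blast
    have "finite T" using TJ J finite_subset by blast
    have "(\<Sum>j\<in>T. \<bar>y \<bullet> v j\<bar>) < (\<Sum>j\<in>T. \<delta>)"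
      using T \<open>finite T\<close> by (intro sum_strict_mono) auto
    also have "\<dots> = Min (insert 1 (d ` F))" by (simp add: \<delta>_def T)
    also have "\<dots> \<le> d T" using \<open>finite F\<close> T TJ by (intro Min_le) (auto simp: F_def)
    finally show False using d(2)[OF TJ T(2) y] by simp
  qed
  ultimately show ?thesis by blast
qed

text \<open>
  By compactness two of the powers of \<open>u\<^bsup>N+1\<^esup>\<close> are closer than \<open>\<epsilon>\<close>; divide one by the other.
\<close>

lemma circle_recurrence:
  assumes u: "cmod u = 1" and "\<epsilon> > 0"
  shows "\<exists>R\<ge>N. cmod (u ^ R - 1) < \<epsilon>"
proof -
  define X where "X = (\<lambda>n. u ^ (n * Suc N))"
  have "bounded (range X)" by (rule boundedI[of _ 1]) (auto simp: X_def norm_power u)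
  then obtain l r where r: "strict_mono r" "(X \<circ> r) \<longlonglongrightarrow> l"
    using bounded_imp_convergent_subsequence by blast
  then obtain M where M: "\<And>m n. m \<ge> M \<Longrightarrow> n \<ge> M \<Longrightarrow> cmod ((X \<circ> r) m - (X \<circ> r) n) < \<epsilon>"
    using CauchyD[OF LIMSEQ_imp_Cauchy, of "X \<circ> r" l \<epsilon>] assms by blast
  define a b where "a = r M" and "b = r (Suc M)"
  have ab: "a < b" using r by (auto simp: a_def b_def strict_mono_def)
  then have "b * Suc N = a * Suc N + (b - a) * Suc N" by (metis add_mult_distrib le_add_diff_inverse less_imp_le)
  then have "X b - X a = u ^ (a * Suc N) * (u ^ ((b - a) * Suc N) - 1)"
    unfolding X_def by (simp only: power_add right_diff_distrib mult_1_right)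
  then have "cmod (X b - X a) = cmod (u ^ ((b - a) * Suc N) - 1)"
    by (simp add: norm_mult norm_power u)
  moreover have "cmod (X b - X a) < \<epsilon>" using M[of "Suc M" M] by (simp add: a_def b_def)
  moreover have "(b - a) * Suc N \<ge> 1 * Suc N" using ab by (intro mult_le_mono1) simp
  ultimately show ?thesis by (metis Suc_leD mult_1)
qed

lemma spaced_recurrences:
  assumes u: "cmod u = 1" and "\<epsilon> > 0"
  shows "\<exists>a::nat \<Rightarrow> nat. \<forall>i. cmod (u ^ a i - 1) < \<epsilon> \<and> b \<le> a i \<and> (\<forall>j<i. a j + b \<le> a i)"
proof -
  have "\<exists>a. \<forall>i. (cmod (u ^ a i - 1) < \<epsilon> \<and> b \<le> a i) \<and> a i + b \<le> a (Suc i)"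
  proof (rule dependent_nat_choice)
    show "\<exists>x. cmod (u ^ x - 1) < \<epsilon> \<and> b \<le> x" using circle_recurrence[OF assms, of b] by blast
    show "\<exists>y. (cmod (u ^ y - 1) < \<epsilon> \<and> b \<le> y) \<and> x + b \<le> y" for x n
      using circle_recurrence[OF assms, of "x + b"] by (metis add_leD2)
  qed
  then obtain a where a: "\<And>i. cmod (u ^ a i - 1) < \<epsilon>" "\<And>i. b \<le> a i" "\<And>i. a i + b \<le> a (Suc i)"
    by blast
  have "a j + b \<le> a i" if "j < i" for i j
    using that
  proof (induction i)
    case (Suc i)
    then show ?case using a(3)[of i] by (cases "j = i") auto
  qed simp
  then show ?thesis using a by blast
qed

lemma rat_apply_householder_tendsto:
  assumes s: "s > 0" and w: "\<And>j. j < s \<Longrightarrow> (\<lambda>N. w N j) \<longlonglongrightarrow> z j" and l: "l < s"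
  shows "(\<lambda>N. rat_apply s (householder s (1 / of_nat (N + i + 3))) (w N) l) \<longlonglongrightarrow> (if l = 0 then - z l else z l)"
proof -
  define \<tau> where "\<tau> = (\<lambda>N. 1 / complex_of_nat (N + (i + 3)))"
  have \<tau>: "\<tau> \<longlonglongrightarrow> 0"
    unfolding \<tau>_def using LIMSEQ_ignore_initial_segment[OF lim_1_over_n, of "i + 3"] by simp
  have sum1: "(\<Sum>i<s. (0::complex) ^ (2 * i)) = 1"
  proof -
    have "(\<Sum>i<s. (0::complex) ^ (2 * i)) = (\<Sum>i<s. if i = 0 then 1 else 0)"
      by (intro sum.cong) auto
    then show ?thesis using s by simp
  qed
  have H: "of_rat (householder s (1 / of_nat (N + i + 3)) l j)
      = (if l = j then 1 else 0) - 2 * \<tau> N ^ (l + j) / (\<Sum>i<s. \<tau> N ^ (2 * i))" for N j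
    by (simp add: householder_def \<tau>_def of_rat_diff of_rat_divide of_rat_mult of_rat_power of_rat_sum of_rat_add add.assoc)
  have "(\<lambda>N. of_rat (householder s (1 / of_nat (N + i + 3)) l j))
      \<longlonglongrightarrow> (if l = j then 1 else 0) - 2 * 0 ^ (l + j) / (\<Sum>i<s. (0::complex) ^ (2 * i))" for j
    unfolding H by (intro tendsto_intros \<tau>) (simp add: sum1)
  then have "(\<lambda>N. rat_apply s (householder s (1 / of_nat (N + i + 3))) (w N) l)
      \<longlonglongrightarrow> (\<Sum>j<s. ((if l = j then 1 else 0) - 2 * 0 ^ (l + j) / 1) * z j)"
    unfolding rat_apply_def sum1 by (intro tendsto_sum tendsto_mult w) auto
  also have "(\<Sum>j<s. ((if l = j then 1 else 0) - 2 * 0 ^ (l + j) / 1) * z j)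
      = (\<Sum>j<s. if l = j then (if l = 0 then - z j else z j) else 0)"
    by (intro sum.cong refl) (auto simp: power_0_left)
  also have "\<dots> = (if l = 0 then - z l else z l)" using l by simp
  finally show ?thesis .
qed

text \<open>
  The limit frame is the diagonal matrix with entries \<open>-1, 1, \<dots>, 1\<close>; its two occurrences cancel.
\<close>

lemma turn_householder_tendsto:
  assumes s: "s > 0" and l: "l < s"
  shows "(\<lambda>N. turn u s (householder s (1 / of_nat (N + i + 3))) E \<sigma> z l) \<longlonglongrightarrow> of_rat \<sigma> * (u powi E l * z l)"
proof -
  have "(\<lambda>N. rat_apply s (householder s (1 / of_nat (N + i + 3))) z j) \<longlonglongrightarrow> (if j = 0 then - z j else z j)"
    if "j < s" for j
    using rat_apply_householder_tendsto[OF s _ that, of "\<lambda>_. z"] by simp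
  then have "(\<lambda>N. rat_apply s (householder s (1 / of_nat (N + i + 3)))
       (\<lambda>j. u powi E j * rat_apply s (householder s (1 / of_nat (N + i + 3))) z j) l)
     \<longlonglongrightarrow> (if l = 0 then - (u powi E l * (if l = 0 then - z l else z l))
        else u powi E l * (if l = 0 then - z l else z l))"
    by (intro rat_apply_householder_tendsto[OF s _ l] tendsto_intros)
  also have "(if l = 0 then - (u powi E l * (if l = 0 then - z l else z l))
        else u powi E l * (if l = 0 then - z l else z l)) = u powi E l * z l" by simp
  finally show ?thesis unfolding turn_def by (intro tendsto_intros)
qed

locale complex_coordinates =
  fixes Z :: "'a::euclidean_space \<Rightarrow> nat \<Rightarrow> complex" and s :: nat
  assumes Z_add: "Z (x + y) l = Z x l + Z y l"
    and Z_scaleR: "Z (a *\<^sub>R x) l = of_real a * Z x l"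
    and norm_Z: "(norm x)\<^sup>2 = (\<Sum>l<s. (cmod (Z x l))\<^sup>2)"
    and Z_surj: "\<exists>x. \<forall>l<s. Z x l = w l"
begin

lemma Z_0 [simp]: "Z 0 l = 0" using Z_scaleR[of 0 0 l] by simp

lemma Z_minus: "Z (- x) l = - Z x l" using Z_scaleR[of "-1" x l] by simp

lemma Z_diff: "Z (x - y) l = Z x l - Z y l"
  using Z_add[of x "- y" l] Z_minus[of y l] by simp

lemma Z_eqI:
  assumes "\<And>l. l < s \<Longrightarrow> Z x l = Z y l"
  shows "x = y"
proof -
  have "(norm (x - y))\<^sup>2 = 0" unfolding norm_Z using assms by (simp add: Z_diff)
  then show ?thesis by simp
qed

definition point :: "(nat \<Rightarrow> complex) \<Rightarrow> 'a" where "point w = (SOME x. \<forall>l<s. Z x l = w l)"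

lemma Z_point [simp]: "l < s \<Longrightarrow> Z (point w) l = w l"
  using someI_ex[OF Z_surj[of w]] unfolding point_def by blast

lemma inner_Z: "x \<bullet> y = (\<Sum>l<s. Re (cnj (Z x l) * Z y l))"
proof -
  have "(cmod (a + b))\<^sup>2 = (cmod a)\<^sup>2 + (cmod b)\<^sup>2 + 2 * Re (cnj a * b)" for a b
    unfolding cmod_power2 by (simp add: power2_eq_square algebra_simps)
  then have "(norm (x + y))\<^sup>2 = (norm x)\<^sup>2 + (norm y)\<^sup>2 + 2 * (\<Sum>l<s. Re (cnj (Z x l) * Z y l))"
    unfolding norm_Z Z_add by (simp add: sum.distrib sum_distrib_left)
  then show ?thesis by (simp add: power2_norm_eq_inner inner_add inner_commute)
qed

text \<open>
  With \<open>\<omega> = u\<^sup>j\<close>, orthogonality is the vanishing of a trigonometric polynomial of degree \<open>s\<close> at \<open>\<omega>\<close>. Multiplied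
  by \<open>\<omega>\<^sup>s\<close> it becomes a polynomial of degree at most \<open>2s\<close>, which has at most \<open>2s\<close> roots.
\<close>

lemma few_orthogonal_phases:
  assumes u: "cmod u = 1" "inj (\<lambda>j::nat. u ^ j)" and c: "\<And>l. l < s \<Longrightarrow> Z c l \<noteq> 0"
    and y: "y \<noteq> 0" and J: "finite J"
  shows "card {j\<in>J. y \<bullet> point (\<lambda>l. u ^ (j * Suc l) * Z c l) = 0} \<le> 2 * s"
proof -
  define d where "d = (\<lambda>l. cnj (Z y l) * Z c l)"
  define P where "P = (\<Sum>l<s. monom (d l) (s + Suc l)) + (\<Sum>l<s. monom (cnj (d l)) (s - Suc l))"
  have "degree P \<le> 2 * s"
    unfolding P_def by (intro degree_add_le degree_sum_le) (auto intro!: order_trans[OF degree_monom_le])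
  moreover have "P \<noteq> 0"
  proof -
    obtain l where l: "l < s" "Z y l \<noteq> 0" using Z_eqI[of y 0] y by auto
    have "coeff P (s + Suc l) = (\<Sum>i<s. if i = l then d i else 0) + (\<Sum>i<s. 0)"
      unfolding P_def coeff_add coeff_sum coeff_monom
      by (intro arg_cong2[where f = "(+)"] sum.cong) auto
    then have "coeff P (s + Suc l) \<noteq> 0" using l c by (simp add: d_def)
    then show ?thesis by auto
  qed
  ultimately have roots: "finite {z. poly P z = 0}" "card {z. poly P z = 0} \<le> 2 * s"
    using poly_roots_finite[of P] card_poly_roots_bound[of P] by auto
  have "poly P (u ^ j) = 0" if "y \<bullet> point (\<lambda>l. u ^ (j * Suc l) * Z c l) = 0" for j
  proof -
    define \<omega> where "\<omega> = u ^ j"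
    have \<omega>: "cnj \<omega> * \<omega> = 1"
      using u complex_norm_square[of \<omega>] by (simp add: \<omega>_def norm_power mult.commute)
    have conj: "cnj (\<omega> ^ Suc l) * \<omega> ^ s = \<omega> ^ (s - Suc l)" if "l < s" for l
    proof -
      have "\<omega> ^ s = \<omega> ^ Suc l * \<omega> ^ (s - Suc l)" using that by (metis Suc_leI le_add_diff_inverse power_add)
      then have "cnj (\<omega> ^ Suc l) * \<omega> ^ s = (cnj \<omega> * \<omega>) ^ Suc l * \<omega> ^ (s - Suc l)"
        by (simp only: complex_cnj_power power_mult_distrib mult.assoc)
      then show ?thesis using \<omega> by simp
    qed
    have "cnj (Z y l) * (u ^ (j * Suc l) * Z c l) = d l * \<omega> ^ Suc l" for l
      by (simp only: d_def \<omega>_def power_mult mult_ac)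
    then have "y \<bullet> point (\<lambda>l. u ^ (j * Suc l) * Z c l) = (\<Sum>l<s. Re (d l * \<omega> ^ Suc l))"
      unfolding inner_Z by (intro sum.cong) (simp_all only: lessThan_iff Z_point)
    then have "0 = (\<Sum>l<s. Re (d l * \<omega> ^ Suc l))" using that by simp
    then have "0 = of_real (2 * (\<Sum>l<s. Re (d l * \<omega> ^ Suc l))) * \<omega> ^ s" by simp
    also have "\<dots> = (\<Sum>l<s. (d l * \<omega> ^ Suc l + cnj (d l * \<omega> ^ Suc l)) * \<omega> ^ s)"
      by (simp only: complex_add_cnj of_real_sum of_real_mult of_real_numeral sum_distrib_left sum_distrib_right)
    also have "\<dots> = (\<Sum>l<s. d l * \<omega> ^ (s + Suc l) + cnj (d l) * \<omega> ^ (s - Suc l))"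
      by (intro sum.cong refl)
        (simp only: lessThan_iff conj[symmetric] power_add complex_cnj_mult ring_distribs mult_ac)
    also have "\<dots> = poly P \<omega>"
      by (simp add: P_def poly_sum poly_monom sum.distrib)
    finally show ?thesis by (simp add: \<omega>_def)
  qed
  then have "(\<lambda>j. u ^ j) ` {j\<in>J. y \<bullet> point (\<lambda>l. u ^ (j * Suc l) * Z c l) = 0} \<subseteq> {z. poly P z = 0}"
    by blast
  then have "card ((\<lambda>j. u ^ j) ` {j\<in>J. y \<bullet> point (\<lambda>l. u ^ (j * Suc l) * Z c l) = 0}) \<le> 2 * s"
    using roots card_mono order_trans by blast
  then show ?thesis by (subst (asm) card_image) (auto intro: inj_on_subset[OF u(2)])
qed

end

lemma sum_even_odd: "(\<Sum>j<2 * s. g j) = (\<Sum>l<s. g (2 * l) + g (2 * l + 1 :: nat))"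
  for g :: "nat \<Rightarrow> 'b::comm_monoid_add"
  by (induction s) (auto simp: add.assoc)

text \<open>
  Pair the real coordinates up.
\<close>

lemma ex_complex_coordinates:
  assumes "CARD('n::finite) = 2 * s"
  shows "\<exists>Z :: real ^ 'n \<Rightarrow> nat \<Rightarrow> complex. complex_coordinates Z s"
proof -
  obtain e where e: "bij_betw e {..<2 * s} (UNIV :: 'n set)"
    using ex_bij_betw_nat_finite[of "UNIV :: 'n set"] assms by (auto simp: atLeast0LessThan)
  define Z where "Z = (\<lambda>(x :: real ^ 'n) l. Complex (x $ e (2 * l)) (x $ e (2 * l + 1)))"
  have "complex_coordinates Z s"
  proof
    fix x :: "real ^ 'n"
    have "(norm x)\<^sup>2 = (\<Sum>i\<in>UNIV. (x $ i)\<^sup>2)"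
      by (simp add: norm_vec_def L2_set_def sum_nonneg)
    also have "\<dots> = (\<Sum>j<2 * s. (x $ e j)\<^sup>2)"
      using sum.reindex_bij_betw[OF e, of "\<lambda>i. (x $ i)\<^sup>2"] by simp
    also have "\<dots> = (\<Sum>l<s. (cmod (Z x l))\<^sup>2)"
      by (simp add: sum_even_odd Z_def cmod_power2)
    finally show "(norm x)\<^sup>2 = (\<Sum>l<s. (cmod (Z x l))\<^sup>2)" .
  next
    fix w
    define g where "g = inv_into {..<2 * s} e"
    have g: "g (e j) = j" if "j < 2 * s" for j
      using e that unfolding g_def by (simp add: bij_betw_inv_into_left)
    define x :: "real ^ 'n" where
      "x = (\<chi> i. if even (g i) then Re (w (g i div 2)) else Im (w (g i div 2)))"
    have "Z x l = w l" if "l < s" for l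
      using g[of "2 * l"] g[of "2 * l + 1"] that by (simp add: Z_def x_def complex_eq_iff)
    then show "\<exists>x. \<forall>l<s. Z x l = w l" by blast
  qed (auto simp: Z_def complex_eq_iff)
  then show ?thesis by blast
qed

section \<open>Rotations spreading a vector in all directions\<close>

lemma turn_scale: "turn u s Q E \<sigma> (\<lambda>l. c * z l) l = c * turn u s Q E \<sigma> z l"
proof -
  have "(\<lambda>j. u powi E j * rat_apply s Q (\<lambda>l. c * z l) j) = (\<lambda>j. c * (u powi E j * rat_apply s Q z j))"
    by (simp add: rat_apply_scale mult_ac)
  then show ?thesis unfolding turn_def by (simp add: rat_apply_scale mult_ac)
qed

context complex_coordinates
begin

definition rotation :: "complex \<Rightarrow> (nat \<Rightarrow> nat \<Rightarrow> rat) \<Rightarrow> (nat \<Rightarrow> int) \<Rightarrow> rat \<Rightarrow> 'a \<Rightarrow> 'a" where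
  "rotation u Q E \<sigma> x = point (turn u s Q E \<sigma> (Z x))"

lemma Z_rotation: "l < s \<Longrightarrow> Z (rotation u Q E \<sigma> x) l = turn u s Q E \<sigma> (Z x) l"
  by (simp add: rotation_def)

lemma rotation_diff: "rotation u Q E \<sigma> (x - y) = rotation u Q E \<sigma> x - rotation u Q E \<sigma> y"
proof (rule Z_eqI)
  fix l assume "l < s"
  moreover have "Z (x - y) = (\<lambda>l. Z x l - Z y l)" by (rule ext) (rule Z_diff)
  ultimately show "Z (rotation u Q E \<sigma> (x - y)) l = Z (rotation u Q E \<sigma> x - rotation u Q E \<sigma> y) l"
    by (simp add: Z_rotation Z_diff turn_diff)
qed

lemma rotation_scaleR: "rotation u Q E \<sigma> (a *\<^sub>R x) = a *\<^sub>R rotation u Q E \<sigma> x"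
proof (rule Z_eqI)
  fix l assume "l < s"
  moreover have "Z (a *\<^sub>R x) = (\<lambda>l. of_real a * Z x l)" by (rule ext) (rule Z_scaleR)
  ultimately show "Z (rotation u Q E \<sigma> (a *\<^sub>R x)) l = Z (a *\<^sub>R rotation u Q E \<sigma> x) l"
    by (simp add: Z_rotation Z_scaleR turn_scale)
qed

lemma rotation_0 [simp]: "rotation u Q E \<sigma> 0 = 0"
  using rotation_scaleR[of u Q E \<sigma> 0 0] by simp

lemma rotation_inverse:
  assumes "rat_frame s Q" "u \<noteq> 0" "\<sigma> * \<sigma> = 1"
  shows "rotation u Q (\<lambda>l. - E l) \<sigma> (rotation u Q E \<sigma> x) = x"
    and "rotation u Q E \<sigma> (rotation u Q (\<lambda>l. - E l) \<sigma> x) = x"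
proof -
  have *: "rotation u Q (\<lambda>l. - E l) \<sigma> (rotation u Q E \<sigma> x) = x" for E
    by (rule Z_eqI) (simp add: Z_rotation turn_inverse[OF assms, of _ _ E "Z x"])
  show "rotation u Q (\<lambda>l. - E l) \<sigma> (rotation u Q E \<sigma> x) = x" by (rule *)
  show "rotation u Q E \<sigma> (rotation u Q (\<lambda>l. - E l) \<sigma> x) = x"
    using *[of "\<lambda>l. - E l"] by simp
qed

lemma norm_rotation:
  assumes "rat_frame s Q" "cmod u = 1" "\<sigma> * \<sigma> = 1"
  shows "norm (rotation u Q E \<sigma> x) = norm x"
proof -
  have "(norm (rotation u Q E \<sigma> x))\<^sup>2 = (norm x)\<^sup>2"
    unfolding norm_Z using turn_norm[OF assms, of E "Z x"] by (simp add: Z_rotation)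
  then show ?thesis by simp
qed

lemma space_isometry_rotation_about:
  assumes "rat_frame s Q" "cmod u = 1" "\<sigma> * \<sigma> = 1"
  shows "space_isometry (\<lambda>x. p + rotation u Q E \<sigma> (x - p))"
  unfolding space_isometry_def
proof (intro conjI allI)
  have u: "u \<noteq> 0" using assms by auto
  show "surj (\<lambda>x. p + rotation u Q E \<sigma> (x - p))"
    by (rule surjI[of _ "\<lambda>y. p + rotation u Q (\<lambda>l. - E l) \<sigma> (y - p)"])
       (simp add: rotation_inverse[OF assms(1) u assms(3)])
  show "dist (p + rotation u Q E \<sigma> (x - p)) (p + rotation u Q E \<sigma> (y - p)) = dist x y" for x y
    using norm_rotation[OF assms, of E "x - y"] by (simp add: dist_norm rotation_diff)
qed

lemma rotation_householder_tendsto: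
  assumes "s > 0"
  shows "(\<lambda>N. rotation u (householder s (1 / of_nat (N + i + 3))) E \<sigma> x)
           \<longlonglongrightarrow> point (\<lambda>l. of_rat \<sigma> * (u powi E l * Z x l))"
proof -
  let ?R = "\<lambda>N. rotation u (householder s (1 / of_nat (N + i + 3))) E \<sigma> x"
  let ?w = "point (\<lambda>l. of_rat \<sigma> * (u powi E l * Z x l))"
  have "(\<lambda>N. \<Sum>l<s. (cmod (Z (?R N) l - Z ?w l))\<^sup>2) \<longlonglongrightarrow> (\<Sum>l<s. (cmod (Z ?w l - Z ?w l))\<^sup>2)"
  proof (intro tendsto_intros)
    fix l assume "l \<in> {..<s}"
    then show "(\<lambda>N. Z (?R N) l) \<longlonglongrightarrow> Z ?w l"
      using turn_householder_tendsto[OF assms, of l u i E \<sigma> "Z x"] by (simp add: Z_rotation)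
  qed
  then have "(\<lambda>N. (norm (?R N - ?w))\<^sup>2) \<longlonglongrightarrow> 0" by (simp add: norm_Z Z_diff)
  then have "(\<lambda>N. sqrt ((norm (?R N - ?w))\<^sup>2)) \<longlonglongrightarrow> sqrt 0" by (rule tendsto_real_sqrt)
  then have "(\<lambda>N. norm (?R N - ?w)) \<longlonglongrightarrow> 0" by simp
  then show ?thesis by (simp add: LIM_zero_iff tendsto_norm_zero_iff)
qed

text \<open>
  The targets are the points \<open>v j\<close> with coordinates \<open>u\<^bsup>j(l+1)\<^esup> Z c l\<close> for \<open>j < 4s + 2\<close>, and their negatives.
  A unit vector is orthogonal to at most \<open>2s\<close> of the \<open>v j\<close>, and each of the other \<open>2s + 2\<close> antipodal pairs has
  one member in its open half-space. The exponents \<open>j(l+1)\<close> would lead to the targets exactly; they are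
  changed by large integers \<open>\<plusminus>a i\<close> with \<open>u\<^bsup>a i\<^esup>\<close> close to \<open>1\<close>, which makes the first exponent the greatest,
  the last one the least, and the last ones distinct. Finally the frames are chosen
  close to the diagonal one.
\<close>

lemma ex_spread_rotations:
  assumes s: "s \<ge> 2" and u: "cmod u = 1" "inj (\<lambda>j::nat. u ^ j)"
    and c: "\<And>l. l < s \<Longrightarrow> Z c l \<noteq> 0" and k: "k \<ge> 8 * s + 4"
  obtains \<delta> :: real and t :: "nat \<Rightarrow> rat" and E :: "nat \<Rightarrow> nat \<Rightarrow> int" and \<sigma> :: "nat \<Rightarrow> rat"
  where "\<delta> > 0" "inj_on t {..<k}" "\<And>i. 0 < t i" "\<And>i. t i < 1 / 2" "\<And>i. \<sigma> i * \<sigma> i = 1"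
    "\<And>i l. \<lbrakk>l < s; l \<noteq> 0\<rbrakk> \<Longrightarrow> E i l < E i 0" "\<And>i l. \<lbrakk>l < s; l \<noteq> s - 1\<rbrakk> \<Longrightarrow> E i (s - 1) < E i l"
    "\<And>i. E i 0 > 0" "\<And>i. E i (s - 1) < 0" "inj (\<lambda>i. E i (s - 1))"
    "\<And>y. norm y = 1 \<Longrightarrow>
       2 * s + 2 \<le> card {i. i < k \<and> \<delta> \<le> y \<bullet> rotation u (householder s (t i)) (E i) (\<sigma> i) c}"
proof -
  define n where "n = 4 * s + 2"
  define q where "q = s - 1"
  have q: "q < s" "q > 0" using s by (auto simp: q_def)
  have u0: "u \<noteq> 0" using u by auto
  define v where "v = (\<lambda>j. point (\<lambda>l. u ^ (j * Suc l) * Z c l))"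
  obtain \<delta> where \<delta>: "\<delta> > 0" "\<And>y. norm y = 1 \<Longrightarrow> card {j\<in>{..<n}. \<bar>y \<bullet> v j\<bar> < \<delta>} \<le> 2 * s"
    using spread_of_few_orthogonal[of "{..<n}" v "2 * s"] few_orthogonal_phases[OF u c, where J = "{..<n}"]
    unfolding v_def by blast
  define \<epsilon> where "\<epsilon> = \<delta> / (4 * (norm c + 1))"
  have \<epsilon>: "\<epsilon> > 0" "\<epsilon> * norm c \<le> \<delta> / 4"
    using \<delta> norm_ge_zero[of c] by (auto simp: \<epsilon>_def field_simps add_pos_nonneg)
  obtain a :: "nat \<Rightarrow> nat" where a: "\<And>i. cmod (u ^ a i - 1) < \<epsilon>" "\<And>i. n * s + 1 \<le> a i" "\<And>i j. j < i \<Longrightarrow> a j + (n * s + 1) \<le> a i"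
    using spaced_recurrences[OF u(1) \<epsilon>(1), of "n * s + 1"] by blast
  \<comment> \<open>The indices 2j and 2j + 1 aim at v j and at its negative; indices beyond the required ones aim at some target again.\<close>
  define J where "J = (\<lambda>i::nat. (i div 2) mod n)"
  define \<sigma> where "\<sigma> = (\<lambda>i::nat. if even i then 1 else - 1 :: rat)"
  define E where "E = (\<lambda>i l. int (J i * Suc l) + (if l = 0 then int (a i) else 0) - (if l = q then int (a i) else 0))"
  have J: "J i < n" for i by (simp add: J_def n_def)
  have J_le: "J i * Suc l \<le> n * s" if "l < s" for i l
    using J[of i] that by (intro mult_le_mono) auto
  have int_s: "int s = int q + 1" using s by (simp add: q_def)
  have E0: "E i 0 = int (J i + a i)" and Eq: "E i q = int (J i * s) - int (a i)" for i
    using q by (simp_all add: E_def int_s algebra_simps)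
  have J_s: "J i * s \<le> n * s" for i
    using J[of i] by (intro mult_le_mono) auto
  have Eq_neg: "E i q < 0" for i
    using J_s[of i] a(2)[of i] unfolding Eq by linarith
  have small_phase: "cmod (u powi E i l - u ^ (J i * Suc l)) \<le> \<epsilon>" for i l
  proof -
    define x where "x = J i * Suc l"
    consider "l = 0" | "l = q" | "l \<noteq> 0" "l \<noteq> q" by blast
    then show ?thesis
    proof cases
      case 1
      then have "E i l = int x + int (a i)" using q by (simp add: E_def x_def)
      then have "u powi E i l - u ^ x = u ^ x * (u ^ a i - 1)"
        using u0 by (simp add: power_int_add algebra_simps)
      then show ?thesis unfolding x_def[symmetric] using a(1)[of i] u by (simp add: norm_mult norm_power)
    next
      case 2
      then have "E i l = int x - int (a i)" using q by (simp add: E_def x_def)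
      then have "u powi E i l * u ^ a i = u ^ x"
        using u0 power_int_add[of u "E i l" "int (a i)"] by simp
      then have "(u powi E i l - u ^ x) * u ^ a i = u ^ x * (1 - u ^ a i)"
        by (simp add: left_diff_distrib right_diff_distrib)
      then have "cmod ((u powi E i l - u ^ x) * u ^ a i) = cmod (u ^ x * (1 - u ^ a i))" by simp
      then have "cmod (u powi E i l - u ^ x) = cmod (1 - u ^ a i)"
        using u by (simp add: norm_mult norm_power)
      then show ?thesis unfolding x_def[symmetric] using a(1)[of i] by (simp add: norm_minus_commute)
    next
      case 3
      then have "E i l = int x" by (simp add: E_def x_def)
      then show ?thesis unfolding x_def[symmetric] using \<epsilon> by simp
    qed
  qed
  define w where "w = (\<lambda>i. point (\<lambda>l. of_rat (\<sigma> i) * (u powi E i l * Z c l)))"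
  have w_near: "norm (w i - real_of_rat (\<sigma> i) *\<^sub>R v (J i)) \<le> \<delta> / 4" for i
  proof -
    have "(norm (w i - real_of_rat (\<sigma> i) *\<^sub>R v (J i)))\<^sup>2 \<le> (\<Sum>l<s. (\<epsilon> * cmod (Z c l))\<^sup>2)"
      unfolding norm_Z
    proof (intro sum_mono power_mono)
      fix l assume l: "l \<in> {..<s}"
      have "Z (w i - real_of_rat (\<sigma> i) *\<^sub>R v (J i)) l = of_rat (\<sigma> i) * ((u powi E i l - u ^ (J i * Suc l)) * Z c l)"
        using l by (auto simp: Z_diff Z_scaleR w_def v_def \<sigma>_def algebra_simps)
      also have "cmod \<dots> = cmod (u powi E i l - u ^ (J i * Suc l)) * cmod (Z c l)"
        by (simp add: norm_mult \<sigma>_def)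
      finally show "cmod (Z (w i - real_of_rat (\<sigma> i) *\<^sub>R v (J i)) l) \<le> \<epsilon> * cmod (Z c l)"
        using small_phase[of i l] by (simp add: mult_right_mono)
    qed auto
    also have "\<dots> = (\<epsilon> * norm c)\<^sup>2"
      by (simp add: power_mult_distrib norm_Z sum_distrib_left)
    finally have "norm (w i - real_of_rat (\<sigma> i) *\<^sub>R v (J i)) \<le> \<epsilon> * norm c"
      by (rule power2_le_imp_le) (use \<epsilon> in simp)
    then show ?thesis using \<epsilon> by simp
  qed
  have "\<forall>\<^sub>F N in sequentially. \<forall>i\<in>{..<k}.
      dist (rotation u (householder s (1 / of_nat (N + i + 3))) (E i) (\<sigma> i) c) (w i) < \<delta> / 4"
  proof (intro eventually_ball_finite ballI)
    fix i assume "i \<in> {..<k}"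
    show "\<forall>\<^sub>F N in sequentially. dist (rotation u (householder s (1 / of_nat (N + i + 3))) (E i) (\<sigma> i) c) (w i) < \<delta> / 4"
      using rotation_householder_tendsto[of u i "E i" "\<sigma> i" c] s \<delta>(1) unfolding w_def by (intro tendstoD) auto
  qed simp
  then obtain N where N: "\<And>i. i < k \<Longrightarrow>
      dist (rotation u (householder s (1 / of_nat (N + i + 3))) (E i) (\<sigma> i) c) (w i) < \<delta> / 4"
    by (auto simp: eventually_sequentially)
  define t where "t = (\<lambda>i::nat. 1 / of_nat (N + i + 3) :: rat)"
  define R where "R = (\<lambda>i. rotation u (householder s (t i)) (E i) (\<sigma> i) c)"
  have R_near: "norm (R i - real_of_rat (\<sigma> i) *\<^sub>R v (J i)) \<le> \<delta> / 2" if "i < k" for i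
    using norm_triangle_le[of "R i - w i" "w i - real_of_rat (\<sigma> i) *\<^sub>R v (J i)" "\<delta> / 2"]
      N[OF that] w_near[of i] by (simp add: R_def t_def dist_norm)
  have cover: "2 * s + 2 \<le> card {i. i < k \<and> \<delta> / 2 \<le> y \<bullet> R i}" if y: "norm y = 1" for y
  proof -
    define S where "S = {..<n} - {j\<in>{..<n}. \<bar>y \<bullet> v j\<bar> < \<delta>}"
    have "n - 2 * s \<le> card S"
      using diff_card_le_card_Diff[of "{j\<in>{..<n}. \<bar>y \<bullet> v j\<bar> < \<delta>}" "{..<n}"] \<delta>(2)[OF y]
      unfolding S_def by simp
    then have S: "2 * s + 2 \<le> card S" by (simp add: n_def)
    define h where "h = (\<lambda>j. if y \<bullet> v j > 0 then 2 * j else 2 * j + 1)"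
    have h_div: "h j div 2 = j" for j by (simp add: h_def)
    have "h ` S \<subseteq> {i. i < k \<and> \<delta> / 2 \<le> y \<bullet> R i}"
    proof
      fix i assume "i \<in> h ` S"
      then obtain j where "j \<in> S" "i = h j" by blast
      then have j: "j < n" "\<delta> \<le> \<bar>y \<bullet> v j\<bar>" "i = h j" by (auto simp: S_def)
      have ik: "i < k" using j k by (auto simp: h_def n_def)
      have Ji: "J i = j" using j h_div by (simp add: J_def)
      have "y \<bullet> (real_of_rat (\<sigma> i) *\<^sub>R v j) = \<bar>y \<bullet> v j\<bar>"
        using j by (auto simp: \<sigma>_def h_def)
      then have "y \<bullet> R i = \<bar>y \<bullet> v j\<bar> + y \<bullet> (R i - real_of_rat (\<sigma> i) *\<^sub>R v (J i))"
        by (simp add: Ji inner_diff_right)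
      moreover have "\<bar>y \<bullet> (R i - real_of_rat (\<sigma> i) *\<^sub>R v (J i))\<bar> \<le> \<delta> / 2"
        using Cauchy_Schwarz_ineq2[of y "R i - real_of_rat (\<sigma> i) *\<^sub>R v (J i)"] R_near[OF ik] y by simp
      ultimately show "i \<in> {i. i < k \<and> \<delta> / 2 \<le> y \<bullet> R i}" using j ik by simp
    qed
    then have "card (h ` S) \<le> card {i. i < k \<and> \<delta> / 2 \<le> y \<bullet> R i}" by (intro card_mono) auto
    moreover have "inj_on h S" by (rule inj_on_inverseI[of _ "\<lambda>i. i div 2"]) (rule h_div)
    ultimately show ?thesis using S by (simp add: card_image)
  qed
  show thesis
  proof (rule that[of "\<delta> / 2" t \<sigma> E])
    show "\<delta> / 2 > 0" using \<delta> by simp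
    show "inj_on t {..<k}" by (auto simp: t_def inj_on_def)
    show "0 < t i" for i by (simp add: t_def)
    show "t i < 1 / 2" for i by (simp add: t_def field_simps)
    show "\<sigma> i * \<sigma> i = 1" for i by (simp add: \<sigma>_def)
    show "E i l < E i 0" if "l < s" "l \<noteq> 0" for i l
    proof -
      have "E i l \<le> int (J i * Suc l)" using that by (simp add: E_def)
      also have "\<dots> < int (a i)" using J_le[OF that(1), of i] a(2)[of i] by linarith
      finally show ?thesis by (simp add: E0)
    qed
    show "E i (s - 1) < E i l" if "l < s" "l \<noteq> s - 1" for i l
    proof -
      have "E i l \<ge> 0" using that by (simp add: E_def q_def)
      then show ?thesis using Eq_neg[of i] by (simp add: q_def)
    qed
    show "E i 0 > 0" for i using a(2)[of i] by (simp add: E0)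
    show "E i (s - 1) < 0" for i
      using Eq_neg[of i] by (simp add: q_def)
    have less: "E i q < E j q" if "j < i" for i j
      using J_s[of i] a(3)[OF that] unfolding Eq by linarith
    show "inj (\<lambda>i. E i (s - 1))"
      by (rule linorder_inj_onI) (use less in \<open>force simp: q_def\<close>)+
    show "2 * s + 2 \<le> card {i. i < k \<and> \<delta> / 2 \<le> y \<bullet> rotation u (householder s (t i)) (E i) (\<sigma> i) c}"
      if "norm y = 1" for y using cover[OF that] by (simp add: R_def)
  qed
qed

end

section \<open>The centre of the affine isometry\<close>

context circle_norm
begin

lemma inj_powers: "inj (\<lambda>j::nat. u ^ j)"
proof (rule injI)
  fix i j :: nat assume "u ^ i = u ^ j"
  then have "(2::real) powi int i = 2 powi int j"
    using u_powi[of "int i" 1] u_powi[of "int j" 1] by simp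
  then have "(2::real) ^ i = 2 ^ j" by simp
  then show "i = j" by simp
qed

lemma householder_last_column_nonzero:
  assumes s: "s \<ge> 2"
  shows "householder s (1 / 2) l (s - 1) \<noteq> 0"
proof -
  define G :: rat where "G = (\<Sum>i<s. (1 / 2) ^ (2 * i))"
  have "(1 / 2 :: rat) ^ (2 * 0) \<le> G"
    unfolding G_def using s by (intro member_le_sum) auto
  then have G: "G \<ge> 1" by simp
  define z :: rat where "z = (1 / 2) ^ (l + (s - 1))"
  have H: "householder s (1 / 2) l (s - 1) = (if l = s - 1 then 1 else 0) - 2 * z / G"
    by (simp only: householder_def G_def z_def)
  have "z > 0" by (simp add: z_def)
  show ?thesis
  proof (cases "l = s - 1")
    case True
    have "z \<le> (1 / 2) ^ 2"
      unfolding z_def using s True by (intro power_decreasing) auto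
    then have "2 * z < G" using G by (simp add: power2_eq_square)
    then show ?thesis using True G unfolding H by simp
  next
    case False
    then show ?thesis using G \<open>z > 0\<close> unfolding H by simp
  qed
qed

text \<open>
  For a turn \<open>L\<close> by \<open>u\<close> and \<open>u\<^sup>-\<^sup>1\<close> in the first and last frame direction, and for \<open>h\<close> the sum of these two
  frame vectors, the vector is \<open>h - L\<^sup>-\<^sup>1 h\<close>: the preimage of the origin under the turn \<open>L\<close> about \<open>h\<close>. In it,
  the last frame vector has the factor \<open>1 - u\<close>, which has a greater norm than the factor \<open>1 - u\<^sup>-\<^sup>1\<close> of the
  first, and no coordinate of the last frame vector vanishes.
\<close>

lemma seed_coordinate_nonzero:
  assumes s: "s \<ge> 2" and l: "l < s"
  defines "E \<equiv> \<lambda>l. (if l = 0 then 1 else 0) - (if l = s - 1 then 1 else 0)"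
    and "h \<equiv> rat_apply s (householder s (1 / 2)) (\<lambda>l. if l = 0 \<or> l = s - 1 then 1 else 0)"
  shows "h l - turn u s (householder s (1 / 2)) (\<lambda>l. - E l) 1 h l \<noteq> 0"
proof -
  define e where "e = (\<lambda>l. if l = 0 \<or> l = s - 1 then 1 else 0 :: complex)"
  define g where "g = (\<lambda>j. (1 - u powi (- E j)) * e j)"
  have frame: "rat_frame s (householder s (1 / 2))" using s by (intro rat_frame_householder) simp
  have "turn u s (householder s (1 / 2)) (\<lambda>l. - E l) 1 h l = rat_apply s (householder s (1 / 2)) (\<lambda>j. u powi (- E j) * e j) l"
    unfolding turn_def h_def e_def[symmetric] using frame
    by (simp, intro rat_apply_cong) (simp add: rat_apply_frame_twice)
  then have "h l - turn u s (householder s (1 / 2)) (\<lambda>l. - E l) 1 h l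
      = rat_apply s (householder s (1 / 2)) (\<lambda>j. e j - u powi (- E j) * e j) l"
    unfolding rat_apply_diff by (simp add: h_def e_def)
  also have "\<dots> = (\<Sum>j<s. of_rat (householder s (1 / 2) l j) * g j)"
    by (simp add: rat_apply_def g_def left_diff_distrib)
  finally have eq: "h l - turn u s (householder s (1 / 2)) (\<lambda>l. - E l) 1 h l
      = (\<Sum>j<s. of_rat (householder s (1 / 2) l j) * g j)" .
  have one_u: "\<nu> (1 - u) = 2"
    using add_dominant[of 1 "- u"] u_mult[of 1] by simp
  have g_last: "\<nu> (g (s - 1)) = 2"
    using s one_u by (simp add: g_def e_def E_def)
  have "\<nu> (g j) < 2" if "j \<noteq> s - 1" for j
  proof (cases "j = 0")
    case True
    have "\<nu> (1 - inverse u) \<le> max 1 (1 / 2)"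
      using diff_le[of 1 "inverse u"] u_mult[of "inverse u"] u_nz by simp
    then show ?thesis using True that by (simp add: g_def e_def E_def power_int_minus)
  qed (use that in \<open>simp add: g_def e_def\<close>)
  then have "\<nu> (\<Sum>j<s. of_rat (householder s (1 / 2) l j) * g j) = \<nu> (g (s - 1))"
    using s householder_last_column_nonzero[OF s, of l] g_last by (intro sum_dominant) auto
  then show ?thesis unfolding eq using g_last by auto
qed

lemma vnorm_rat_scale: "q \<noteq> 0 \<Longrightarrow> vnorm s (\<lambda>l. of_rat q * z l) = vnorm s z"
  by (simp add: vnorm_def rat_mult)

end

text \<open>
  Close to the sphere, \<open>\<parallel>y - c\<parallel>\<^sup>2 = \<parallel>y\<parallel>\<^sup>2 - 2 y \<bullet> c + \<parallel>c\<parallel>\<^sup>2\<close>, where the linear term prevails for small \<open>c\<close>; deep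
  inside the ball the triangle inequality suffices.
\<close>

lemma near_preimage_in_ball:
  fixes y c :: "'a::real_inner"
  assumes "c \<noteq> 0" "r > 0" "\<delta> > 0" "norm y \<le> r" "norm c < r / 2" "norm c < r * \<delta>"
    and dir: "norm c * \<delta> * norm y \<le> y \<bullet> c"
  shows "norm (y - c) < r"
proof (cases "norm y < r / 2")
  case True
  then show ?thesis using assms norm_triangle_ineq4[of y c] by simp
next
  case False
  have "norm c * norm c < norm c * (r * \<delta>)"
    using assms by (intro mult_strict_left_mono) auto
  also have "\<dots> \<le> norm c * (2 * norm y * \<delta>)"
    using False assms by (intro mult_left_mono mult_right_mono) auto
  also have "\<dots> \<le> 2 * (y \<bullet> c)" using dir by (simp add: mult_ac)
  finally have "norm c * norm c < 2 * (y \<bullet> c)" .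
  moreover have "(norm (y - c))\<^sup>2 = (norm y)\<^sup>2 - 2 * (y \<bullet> c) + (norm c)\<^sup>2"
    by (simp add: power2_norm_eq_inner inner_diff inner_commute)
  ultimately have "(norm (y - c))\<^sup>2 < (norm y)\<^sup>2"
    using power2_eq_square[of "norm c"] by linarith
  also have "\<dots> \<le> r\<^sup>2" using assms by (intro power_mono) auto
  finally show ?thesis by (rule power2_less_imp_less) (use assms in simp)
qed

section \<open>Balls are divisible\<close>

text \<open>
  The frame of the affine isometry has the parameter \<open>1 / 2\<close>, those of the rotations have smaller ones. The
  fixed point \<open>p\<close> is a rational vector in that frame and is divided by a large integer \<open>M\<close>; this makes
  \<open>c\<close> short for the Euclidean norm and does not affect heights.
\<close>

theorem (in complex_coordinates) origin_ball_divisible: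
  assumes s: "s \<ge> 2" and r: "r > 0" and B: "B = ball 0 r \<or> B = cball (0::'a) r" and m: "m \<ge> 8 * s + 5"
  shows "divisible {..<m} B"
proof -
  obtain u \<nu> where "circle_norm u \<nu>" using ex_circle_norm by blast
  then interpret circle_norm u \<nu> .
  define k where "k = m - 1"
  have mk: "{..<m} = {..k}" "k \<ge> 8 * s + 4" using m by (auto simp: k_def)
  define H where "H = householder s (1 / 2)"
  define E0 :: "nat \<Rightarrow> int" where "E0 = (\<lambda>l. (if l = 0 then 1 else 0) - (if l = s - 1 then 1 else 0))"
  define e where "e = (\<lambda>l. if l = 0 \<or> l = s - 1 then 1 else 0 :: complex)"
  define h where "h = rat_apply s H e"
  have frame: "rat_frame s (householder s t)" for t using s by (intro rat_frame_householder) simp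
  then have frameH: "rat_frame s H" by (simp add: H_def)
  \<comment> \<open>Up to scaling, p0 will be the fixed point of the affine isometry and c0 the preimage of the origin.\<close>
  define p0 where "p0 = point h"
  define c0 where "c0 = p0 - rotation u H (\<lambda>l. - E0 l) 1 p0"
  have c0_nz: "Z c0 l \<noteq> 0" if "l < s" for l
  proof -
    have "Z c0 l = h l - turn u s H (\<lambda>l. - E0 l) 1 h l"
      using that turn_cong[of s "Z p0" h u H "\<lambda>l. - E0 l" 1 l]
      by (simp add: c0_def Z_diff Z_rotation p0_def)
    then show ?thesis
      using seed_coordinate_nonzero[OF s that] unfolding h_def H_def e_def E0_def by simp
  qed
  have c0: "c0 \<noteq> 0" using c0_nz[of 0] s by auto
  obtain \<delta> t E \<sigma> where \<delta>: "\<delta> > 0"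
    and t: "inj_on t {..<k}" "\<And>i. 0 < t i" "\<And>i. t i < 1 / 2" and \<sigma>: "\<And>i. \<sigma> i * \<sigma> i = (1::rat)"
    and E: "\<And>i l. l < s \<Longrightarrow> l \<noteq> 0 \<Longrightarrow> E i l < E i 0" "\<And>i l. l < s \<Longrightarrow> l \<noteq> s - 1 \<Longrightarrow> E i (s - 1) < E i l"
      "\<And>i. E i 0 > 0" "\<And>i. E i (s - 1) < 0" "inj (\<lambda>i::nat. E i (s - 1))"
    and spread: "\<And>y. norm y = 1 \<Longrightarrow>
        2 * s + 2 \<le> card {i. i < k \<and> \<delta> \<le> y \<bullet> rotation u (householder s (t i)) (E i) (\<sigma> i) c0}"
    by (rule ex_spread_rotations[OF s norm_u inj_powers c0_nz mk(2)]) blast+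
  \<comment> \<open>The first bound makes M positive, the other two make c short enough for the distance estimate.\<close>
  obtain M :: nat where M: "real M > max (max 1 (2 * norm c0 / r)) ((norm c0)\<^sup>2 / (r * \<delta>))"
    using reals_Archimedean2 by blast
  then have M1: "real M > 0" and M2: "norm c0 / M < r / 2" and M3: "(norm c0)\<^sup>2 / M < r * \<delta>"
    using r \<delta> by (auto simp: field_simps)
  define p c where "p = (1 / real M) *\<^sub>R p0" and "c = (1 / real M) *\<^sub>R c0"
  define t' where "t' = (\<lambda>i. if i < k then t i else 1 / 2)"
  define E' where "E' = (\<lambda>i. if i < k then E i else E0)"
  define \<sigma>' where "\<sigma>' = (\<lambda>i. if i < k then \<sigma> i else 1)"
  define f where "f = (\<lambda>i x. if i < k then rotation u (householder s (t i)) (E i) (\<sigma> i) x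
                              else p + rotation u H E0 1 (x - p))"
  have fi: "f i x = rotation u (householder s (t i)) (E i) (\<sigma> i) x" if "i < k" for i x
    using that by (simp add: f_def)
  have fk: "f k x = p + rotation u H E0 1 (x - p)" for x by (simp add: f_def)
  have iso: "space_isometry (f i)" for i
  proof (cases "i < k")
    case True
    then show ?thesis
      using space_isometry_rotation_about[OF frame[of "t i"] norm_u \<sigma>[of i], where p = 0 and E = "E i"] by (simp add: f_def)
  next
    case False
    then show ?thesis
      using space_isometry_rotation_about[OF frameH norm_u, where \<sigma> = 1 and p = p and E = E0] by (simp add: f_def)
  qed
  then have dist_f: "dist (f i x) (f i y) = dist x y" for i x y by (simp add: space_isometry_def)
  then have inj_f: "inj (f i)" for i by (metis injI dist_eq_0_iff)
  have f_onto: "\<exists>x. f i x = y" for i y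
    using iso[of i] unfolding space_isometry_def by (metis surj_def)
  have f0: "f i 0 = 0" if "i < k" for i using that by (simp add: f_def)
  \<comment> \<open>The point c - p is minus the preimage of p under the linear part.\<close>
  have fk_c: "f k c = 0"
  proof -
    have "c - p = - ((1 / real M) *\<^sub>R rotation u H (\<lambda>l. - E0 l) 1 p0)"
      by (simp add: c_def p_def c0_def scaleR_diff_right)
    then have "rotation u H E0 1 (c - p) = (- 1 / real M) *\<^sub>R rotation u H E0 1 (rotation u H (\<lambda>l. - E0 l) 1 p0)"
      by (metis (no_types, lifting) divide_minus_left rotation_scaleR scaleR_minus_left)
    also have "\<dots> = - p" using rotation_inverse(2)[OF frameH u_nz, of 1 E0 p0] by (simp add: p_def)
    finally show ?thesis by (simp add: fk)
  qed
  have B_norm: "x \<in> B \<Longrightarrow> norm y = norm x \<Longrightarrow> y \<in> B" and B_le: "x \<in> B \<Longrightarrow> norm x \<le> r"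
    and B_less: "norm x < r \<Longrightarrow> x \<in> B" for x y
    using B by auto
  have norm_fi: "norm (f i x) = norm x" if "i < k" for i x
    using dist_f[of i x 0] f0[OF that] by simp
  have norm_c: "norm c = norm c0 / M" using M1 by (simp add: c_def)
  have norm_fk: "norm (f k x) = dist x c" for x
    using dist_f[of k x c] fk_c by simp
  have cover: "2 * s + 2 \<le> card {i. i < k \<and> (\<exists>x\<in>B. f k x \<in> B \<and> f i x = y)}" if y: "y \<in> B" "y \<noteq> 0" for y
  proof -
    define y1 where "y1 = (1 / norm y) *\<^sub>R y"
    have y1: "norm y1 = 1" "y = norm y *\<^sub>R y1" using y by (auto simp: y1_def)
    have "{i. i < k \<and> \<delta> \<le> y1 \<bullet> rotation u (householder s (t i)) (E i) (\<sigma> i) c0}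
        \<subseteq> {i. i < k \<and> (\<exists>x\<in>B. f k x \<in> B \<and> f i x = y)}"
    proof safe
      fix i assume i: "i < k" and dir: "\<delta> \<le> y1 \<bullet> rotation u (householder s (t i)) (E i) (\<sigma> i) c0"
      obtain x where x: "f i x = y" using f_onto by blast
      have xB: "x \<in> B" using B_norm[OF y(1)] norm_fi[OF i, of x] x by simp
      have fic: "f i c = (1 / real M) *\<^sub>R rotation u (householder s (t i)) (E i) (\<sigma> i) c0"
        using i by (simp add: fi c_def rotation_scaleR)
      have "y \<bullet> f i c = norm y / M * (y1 \<bullet> rotation u (householder s (t i)) (E i) (\<sigma> i) c0)"
        by (subst y1(2)) (simp add: fic)
      also have "\<dots> \<ge> norm y / M * \<delta>"
        using dir by (intro mult_left_mono) auto
      finally have ip: "norm (f i c) * (\<delta> / norm c0) * norm y \<le> y \<bullet> f i c"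
        using c0 by (simp add: norm_fi[OF i] norm_c mult_ac)
      have "norm (y - f i c) < r"
      proof (rule near_preimage_in_ball[of _ r "\<delta> / norm c0"])
        show "f i c \<noteq> 0" using norm_fi[OF i, of c] norm_c c0 M1 by auto
        show "norm (f i c) < r * (\<delta> / norm c0)"
          using M3 c0 by (simp add: norm_fi[OF i] norm_c field_simps power2_eq_square)
      qed (use r \<delta> c0 M2 ip B_le[OF y(1)] in \<open>auto simp: norm_fi[OF i] norm_c\<close>)
      moreover have "norm (f k x) = norm (y - f i c)"
        using dist_f[of i x c] x by (simp add: norm_fk dist_norm)
      ultimately show "\<exists>x\<in>B. f k x \<in> B \<and> f i x = y" using B_less[of "f k x"] xB x by (intro bexI[of _ x]) auto
    qed
    then have "card {i. i < k \<and> \<delta> \<le> y1 \<bullet> rotation u (householder s (t i)) (E i) (\<sigma> i) c0}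
        \<le> card {i. i < k \<and> (\<exists>x\<in>B. f k x \<in> B \<and> f i x = y)}"
      by (intro card_mono) auto
    then show ?thesis using spread[OF y1(1)] by simp
  qed
  have t': "t' i > 0" "i \<le> k \<Longrightarrow> j \<le> k \<Longrightarrow> i \<noteq> j \<Longrightarrow> t' i \<noteq> t' j" for i j
    using t(1) t(2)[of i] t(3)[of i] t(3)[of j] by (auto simp: t'_def inj_on_def)
  \<comment> \<open>Distinct rotations have distinct frame parameters, so the bound on parameters is one on indices.\<close>
  have few: "card {i. i < k \<and> \<nu> (rat_apply s (householder s (t' i)) (Z y) (s - 1)) < vnorm s (Z y)} \<le> 2 * s - 2"
    if "y \<noteq> 0" for y
  proof -
    let ?I = "{i. i < k \<and> \<nu> (rat_apply s (householder s (t' i)) (Z y) (s - 1)) < vnorm s (Z y)}"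
    have "vnorm s (Z y) > 0"
      using that Z_eqI[of y 0] vnorm_eq_0[of s "Z y"] vnorm_nonneg[of s "Z y"] by force
    then have "card (t' ` ?I) \<le> 2 * s - 2"
      by (intro few_contracting_frames[OF s]) auto
    moreover have "inj_on t' {..k}" by (metis t'(2) atMost_iff inj_onI)
    then have "inj_on t' ?I" by (rule inj_on_subset) auto
    ultimately show ?thesis by (simp add: card_image)
  qed
  have Zp: "Z p l = of_rat (1 / of_nat M) * h l" if "l < s" for l
    using that by (simp add: p_def p0_def Z_scaleR of_rat_divide)
  have Mq: "1 / of_nat M \<noteq> (0::rat)" using M1 by simp
  have Hp: "rat_apply s H (Z p) l = of_rat (1 / of_nat M) * e l" if "l < s" for l
  proof -
    have "rat_apply s H (Z p) l = rat_apply s H (\<lambda>l. of_rat (1 / of_nat M) * h l) l"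
      using Zp by (rule rat_apply_cong)
    then show ?thesis using that by (simp only: rat_apply_scale h_def rat_apply_frame_twice[OF frameH])
  qed
  have "vnorm s (Z p) = vnorm s (rat_apply s H (Z p))" by (rule vnorm_rat_apply[OF frameH, symmetric])
  also have "\<dots> = vnorm s (\<lambda>l. of_rat (1 / of_nat M) * e l)" using Hp by (rule vnorm_cong)
  also have "\<dots> = vnorm s e" by (rule vnorm_rat_scale[OF Mq])
  also have "\<dots> = 1"
  proof (rule antisym)
    show "vnorm s e \<le> 1" by (rule vnorm_le) (auto simp: e_def)
    show "1 \<le> vnorm s e" using vnorm_ge[of 0 s e] s by (simp add: e_def)
  qed
  finally have vp: "vnorm s (Z p) = 1" .
  have "ball_motions u \<nu> s k (\<lambda>i. householder s (t' i)) E' \<sigma>' Z f p c B"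
  proof
    show "s \<ge> 2" by (rule s)
    show "x = y" if "\<And>l. l < s \<Longrightarrow> Z x l = Z y l" for x y by (rule Z_eqI) (rule that)
    show "Z 0 l = 0" for l by simp
    show "rat_frame s (householder s (t' i))" for i by (rule frame)
    show "(\<Sum>l<s. householder s (t' i) (s - 1) l * householder s (t' j) l 0) \<noteq> 0" if "i \<le> k" "j \<le> k" "i \<noteq> j" for i j
      using householder_cross_nonzero[OF s t'(1) t'(1) t'(2)[OF that]] .
    show "E' i l < E' i 0" if "l < s" "l \<noteq> 0" for i l
      using E(1)[OF that] that s by (auto simp: E'_def E0_def)
    show "E' i (s - 1) < E' i l" if "l < s" "l \<noteq> s - 1" for i l
      using E(2)[OF that] that s by (auto simp: E'_def E0_def)
    show "E' i 0 > 0" for i using E(3) s by (auto simp: E'_def E0_def)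
    show "E' i (s - 1) < 0" for i using E(4)[of i] s by (auto simp: E'_def E0_def)
    show "inj_on (\<lambda>i. E' i (s - 1)) {..<k}"
      using E(5) by (auto simp: inj_on_def E'_def)
    show "\<sigma>' i * \<sigma>' i = 1" for i by (simp add: \<sigma>'_def \<sigma>)
    show "Z (f i x) l = turn u s (householder s (t' i)) (E' i) (\<sigma>' i) (Z x) l" if "i < k" "l < s" for i l x
      using that by (simp add: fi Z_rotation t'_def E'_def \<sigma>'_def)
    show "Z (f k x) l = Z p l + turn u s (householder s (t' k)) (E' k) (\<sigma>' k) (\<lambda>l. Z x l - Z p l) l" if "l < s" for l x
      using that turn_diff[of u s H E0 1 "Z x" "Z p" l]
      by (simp add: fk rotation_diff Z_add Z_diff Z_rotation t'_def E'_def \<sigma>'_def H_def)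
    show "\<nu> (rat_apply s (householder s (t' k)) (Z p) 0) = 1" "\<nu> (rat_apply s (householder s (t' k)) (Z p) (s - 1)) = 1"
      using Hp[of 0] Hp[of "s - 1"] s rat_mult[OF Mq, of 1] by (simp_all add: t'_def H_def e_def)
    show "c \<in> B" by (rule B_less) (use norm_c M2 r in linarith)
    show "0 \<in> B" using r by (intro B_less) simp
  qed (use few inj_f f0 vp fk_c cover in auto)
  then have "\<exists>A\<subseteq>B. (\<forall>x\<in>A. f k x \<in> B) \<and> (\<forall>y\<in>B. \<exists>!(i, x). i \<in> {..k} \<and> x \<in> A \<and> f i x = y)"
    by (rule ball_motions.exact_cover)
  then obtain A where A: "A \<subseteq> B" "\<forall>x\<in>A. f k x \<in> B"
    "\<forall>y\<in>B. \<exists>!(i, x). i \<in> {..k} \<and> x \<in> A \<and> f i x = y"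
    by (elim exE conjE) (rule that)
  have covered: "\<exists>i x. i \<le> k \<and> x \<in> A \<and> f i x = y" if "y \<in> B" for y
    using ex1_implies_ex[OF bspec[OF A(3) that]] by auto
  have covered_once: "i = j" if "i \<le> k" "x \<in> A" "j \<le> k" "x' \<in> A" "f i x = f j x'" "f i x \<in> B" for i j x x'
  proof -
    note ex1 = bspec[OF A(3) that(6)]
    obtain z where z: "\<And>w. (case w of (i', v) \<Rightarrow> i' \<in> {..k} \<and> v \<in> A \<and> f i' v = f i x) \<Longrightarrow> w = z"
      using ex1 by (elim ex1E) (rule that, drule spec, erule mp)
    have "(i, x) = z" "(j, x') = z" using that by (auto intro!: z)
    then have "(i, x) = (j, x')" by simp
    then show ?thesis by simp
  qed
  have fA: "f i x \<in> B" if "i \<le> k" "x \<in> A" for i x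
  proof (cases "i < k")
    case True
    then show ?thesis using A(1) that B_norm[of x "f i x"] norm_fi by blast
  next
    case False
    then have "i = k" using that by simp
    then show ?thesis using A(2) that by blast
  qed
  have disjoint: "disjoint_family_on (\<lambda>i. f i ` A) {..k}"
    unfolding disjoint_family_on_def
  proof (intro ballI impI)
    fix i j assume ij: "i \<in> {..k}" "j \<in> {..k}" "i \<noteq> j"
    have False if x: "x \<in> A" "x' \<in> A" "f i x = f j x'" for x x'
    proof -
      have "f i x \<in> B" using fA[of i x] ij(1) x(1) by simp
      then show False using covered_once[of i x j x'] ij x by simp
    qed
    then show "f i ` A \<inter> f j ` A = {}" by blast
  qed
  have union: "(\<Union>i\<in>{..k}. f i ` A) = B"
  proof
    show "(\<Union>i\<in>{..k}. f i ` A) \<subseteq> B" using fA by auto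
    show "B \<subseteq> (\<Union>i\<in>{..k}. f i ` A)" using covered by fastforce
  qed
  have congruent: "congruent_sets (f i ` A) (f j ` A)" for i j
    unfolding congruent_sets_def
  proof (intro exI conjI)
    have bij: "bij (f i)" using inj_f f_onto by (metis bij_betw_def surj_def)
    show "space_isometry (f j \<circ> inv (f i))"
      unfolding space_isometry_def
    proof (intro conjI allI)
      show "surj (f j \<circ> inv (f i))"
        using iso[of j] bij by (intro comp_surj) (auto simp: space_isometry_def bij_imp_bij_inv bij_is_surj)
      show "dist ((f j \<circ> inv (f i)) x) ((f j \<circ> inv (f i)) y) = dist x y" for x y
        using dist_f[of i "inv (f i) x" "inv (f i) y"] bij by (simp add: dist_f bij_is_surj surj_f_inv_f)
    qed
    show "(f j \<circ> inv (f i)) ` f i ` A = f j ` A"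
      using inj_f[of i] by (simp add: image_comp comp_def)
  qed
  show ?thesis
    unfolding mk(1) divisible_def using disjoint union congruent by blast
qed

lemma divisible_translation:
  fixes K :: "'a::real_normed_vector set"
  assumes "divisible I K"
  shows "divisible I ((+) c ` K)"
proof -
  obtain P where P: "disjoint_family_on P I" "(\<Union>i\<in>I. P i) = K"
    "\<And>i j. i \<in> I \<Longrightarrow> j \<in> I \<Longrightarrow> congruent_sets (P i) (P j)"
    using assms unfolding divisible_def by blast
  show ?thesis
    unfolding divisible_def
  proof (intro exI[of _ "\<lambda>i. (+) c ` P i"] conjI ballI)
    show "disjoint_family_on (\<lambda>i. (+) c ` P i) I"
      using P(1) unfolding disjoint_family_on_def by fastforce
    show "(\<Union>i\<in>I. (+) c ` P i) = (+) c ` K" using P(2) by blast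
  next
    fix i j assume "i \<in> I" "j \<in> I"
    then obtain g where g: "surj g" "\<And>x y. dist (g x) (g y) = dist x y" "g ` P i = P j"
      using P(3) unfolding congruent_sets_def space_isometry_def by blast
    have "surj (\<lambda>x. c + g (x - c))"
    proof (rule surjI)
      show "c + g ((c + inv g (y - c)) - c) = y" for y
        using g(1) by (simp add: surj_f_inv_f)
    qed
    moreover have "dist (c + g (x - c)) (c + g (y - c)) = dist x y" for x y
      using g(2)[of "x - c" "y - c"] by (simp add: dist_norm)
    ultimately have "space_isometry (\<lambda>x. c + g (x - c))" by (simp add: space_isometry_def)
    moreover have "(\<lambda>x. c + g (x - c)) ` (+) c ` P i = (+) c ` P j"
      unfolding g(3)[symmetric] by (simp add: image_comp comp_def)
    ultimately show "congruent_sets ((+) c ` P i) ((+) c ` P j)"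
      unfolding congruent_sets_def by blast
  qed
qed

theorem theorem1p1:
  fixes s m :: nat and c :: "real ^ 'n" and r :: real and B :: "(real ^ 'n) set"
  assumes "s \<ge> 2" and "s \<noteq> 3"
    and "CARD('n) = 2 * s"
    and "r > 0" and "B = ball c r \<or> B = cball c r"
    and "m \<ge> 4 * (2 * s + 1) + 2"
  shows "divisible {..<m} B"
proof -
  obtain Z :: "real ^ 'n \<Rightarrow> nat \<Rightarrow> complex" where "complex_coordinates Z s"
    using ex_complex_coordinates[OF assms(3)] by blast
  then interpret complex_coordinates Z s .
  have "divisible {..<m} (ball (0 :: real ^ 'n) r)" "divisible {..<m} (cball (0 :: real ^ 'n) r)"
    using assms by (auto intro: origin_ball_divisible)
  then have "divisible {..<m} (ball c r)" "divisible {..<m} (cball c r)"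
    using divisible_translation[of "{..<m}" "ball 0 r" c] divisible_translation[of "{..<m}" "cball 0 r" c]
    by simp_all
  then show ?thesis using assms(5) by auto
qed

end
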